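(* Let $A$ be an almost Dedekind domain which has weak factorization, and let $Z$ denote the set of noninvertible maximal ideals of $A$. The following assertions are equivalent. (a) $A$ is an SP-domain. (b) $A$ is an ISP-domain. (c) For every clean ideal $H$ of $A$, the set $V_2(H)$ is finite. (d) Every $M\in Z$ contains a clean ideal $H$ such that $V_2(H)$ is finite.
   Context: All rings are commutative and unitary; "ideal" of a domain means integral ideal. A domain $A$ is almost Dedekind if for every maximal ideal $M$ of $A$ the localization $A_M$ is a rank one discrete valuation domain (DVR). A domain $A$ has weak factorization if every nonzero nondivisorial ideal $I$ of $A$ can be factored as $I=I_\nu M_1M_2\cdots M_n$, where $I_\nu=(I^{-1})^{-1}$ is the divisorial closure of $I$ and $M_1,\dots,M_n$ are (finitely many) maximal ideals of $A$; $I$ is nondivisorial if $I\neq I_\nu$. A domain $A$ is an SP-domain if every ideal of $A$ is a (finite) product of radical ideals. A domain $A$ is an ISP-domain (invertible semiprime domain) if every proper nonzero ideal $I$ of $A$ can be written as $I=JQ_1\cdots Q_n$ where $n\geq 1$, $J$ is an invertible ideal of $A$ and each $Q_i$ is a proper radical ideal of $A$. For an almost Dedekind domain $A$, an ideal $I$ of $A$ and $n\geq 1$, put $V_n(I)=\{M\in \mathrm{Max}(A)\mid I\subseteq M^n\}$, and $V(I)=V_1(I)$. An ideal $H$ of $A$ is called a clean ideal if $H$ is invertible, $V(H)\cap Z=\{M\}$ for some single maximal ideal $M$, and $H\not\subseteq M^2$ for this $M$. *)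

theory Defs
  imports
    "HOL-Algebra.Algebra"
    "HOL-Decision_Procs.Algebra_Aux"
begin

text \<open>
  A domain is a subring \<open>A\<close> of a field, the field being a type \<open>'k :: field\<close>, such that every
  element of \<open>'k\<close> is a quotient of elements of \<open>A\<close>. Ideals of \<open>A\<close>, fractional ideals and
  localizations are then subsets of \<open>'k\<close>.
\<close>

definition ring_on :: "'k::field set \<Rightarrow> 'k ring" where
  "ring_on A = cring_class_ops\<lparr>carrier := A\<rparr>"

definition domain_with_quotient_field :: "'k::field set \<Rightarrow> bool" where
  "domain_with_quotient_field A \<longleftrightarrow>
     domain (ring_on A) \<and> (\<forall>x. \<exists>a\<in>A. \<exists>b\<in>A. b \<noteq> 0 \<and> x = a / b)"

definition max_ideals :: "'k::field set \<Rightarrow> 'k set set" where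
  "max_ideals A = {M. maximalideal M (ring_on A)}"

definition ideal_list_prod :: "'k::field set \<Rightarrow> 'k set list \<Rightarrow> 'k set" where
  "ideal_list_prod A Is = foldr (ideal_prod (ring_on A)) Is A"

definition ideal_power :: "'k::field set \<Rightarrow> 'k set \<Rightarrow> nat \<Rightarrow> 'k set" where
  "ideal_power A I n = I [^]\<^bsub>ideals_set (ring_on A)\<^esub> n"

text \<open>The colon \<open>(A : I)\<close> in the quotient field, that is, \<open>I\<close> to the power \<open>-1\<close>.\<close>

definition frac_inverse :: "'k::field set \<Rightarrow> 'k set \<Rightarrow> 'k set" where
  "frac_inverse A I = {x. \<forall>i\<in>I. x * i \<in> A}"

definition div_closure :: "'k::field set \<Rightarrow> 'k set \<Rightarrow> 'k set" where
  "div_closure A I = frac_inverse A (frac_inverse A I)"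

text \<open>
  The second factor below is a fractional ideal, so the product is formed in the quotient field.
\<close>

definition invertible_ideal :: "'k::field set \<Rightarrow> 'k set \<Rightarrow> bool" where
  "invertible_ideal A I \<longleftrightarrow>
     ideal I (ring_on A) \<and> ideal_prod cring_class_ops I (frac_inverse A I) = A"

definition radical :: "'k::field set \<Rightarrow> 'k set \<Rightarrow> 'k set" where
  "radical A I = {x \<in> A. \<exists>n>0. x ^ n \<in> I}"

definition radical_ideal :: "'k::field set \<Rightarrow> 'k set \<Rightarrow> bool" where
  "radical_ideal A I \<longleftrightarrow> ideal I (ring_on A) \<and> radical A I = I"

definition localization :: "'k::field set \<Rightarrow> 'k set \<Rightarrow> 'k set" where
  "localization A M = {a / b | a b. a \<in> A \<and> b \<in> A - M}"

text \<open>The value at \<open>0\<close> is irrelevant; it plays the role of infinity.\<close>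

definition discrete_valuation :: "('k::field \<Rightarrow> int) \<Rightarrow> bool" where
  "discrete_valuation v \<longleftrightarrow>
     v ` (- {0}) = UNIV \<and>
     (\<forall>x y. x \<noteq> 0 \<longrightarrow> y \<noteq> 0 \<longrightarrow> v (x * y) = v x + v y) \<and>
     (\<forall>x y. x \<noteq> 0 \<longrightarrow> y \<noteq> 0 \<longrightarrow> x + y \<noteq> 0 \<longrightarrow> min (v x) (v y) \<le> v (x + y))"

definition is_DVR :: "'k::field set \<Rightarrow> bool" where
  "is_DVR D \<longleftrightarrow> (\<exists>v. discrete_valuation v \<and> D = {x. x = 0 \<or> 0 \<le> v x})"

definition almost_dedekind :: "'k::field set \<Rightarrow> bool" where
  "almost_dedekind A \<longleftrightarrow>
     domain_with_quotient_field A \<and> (\<forall>M \<in> max_ideals A. is_DVR (localization A M))"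

definition weak_factorization :: "'k::field set \<Rightarrow> bool" where
  "weak_factorization A \<longleftrightarrow>
     (\<forall>I. ideal I (ring_on A) \<and> I \<noteq> {0} \<and> I \<noteq> div_closure A I \<longrightarrow>
        (\<exists>Ms. Ms \<noteq> [] \<and> set Ms \<subseteq> max_ideals A \<and>
           I = ideal_prod (ring_on A) (div_closure A I) (ideal_list_prod A Ms)))"

definition SP_domain :: "'k::field set \<Rightarrow> bool" where
  "SP_domain A \<longleftrightarrow>
     domain_with_quotient_field A \<and>
     (\<forall>I. ideal I (ring_on A) \<longrightarrow>
        (\<exists>Qs. (\<forall>Q \<in> set Qs. radical_ideal A Q) \<and> I = ideal_list_prod A Qs))"

definition ISP_domain :: "'k::field set \<Rightarrow> bool" where
  "ISP_domain A \<longleftrightarrow>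
     domain_with_quotient_field A \<and>
     (\<forall>I. ideal I (ring_on A) \<and> I \<noteq> {0} \<and> I \<noteq> A \<longrightarrow>
        (\<exists>J Qs. invertible_ideal A J \<and> Qs \<noteq> [] \<and>
           (\<forall>Q \<in> set Qs. radical_ideal A Q \<and> Q \<noteq> A) \<and>
           I = ideal_prod (ring_on A) J (ideal_list_prod A Qs)))"

definition V_set :: "'k::field set \<Rightarrow> nat \<Rightarrow> 'k set \<Rightarrow> 'k set set" where
  "V_set A n I = {M \<in> max_ideals A. I \<subseteq> ideal_power A M n}"

definition noninvertible_max_ideals :: "'k::field set \<Rightarrow> 'k set set" where
  "noninvertible_max_ideals A = {M \<in> max_ideals A. \<not> invertible_ideal A M}"

definition clean_ideal :: "'k::field set \<Rightarrow> 'k set \<Rightarrow> bool" where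
  "clean_ideal A H \<longleftrightarrow>
     invertible_ideal A H \<and>
     (\<exists>M. V_set A 1 H \<inter> noninvertible_max_ideals A = {M} \<and> \<not> H \<subseteq> ideal_power A M 2)"

end

theory Submission
  imports Defs
begin

text \<open>
  Write \<open>v\<^sub>M\<close> for the valuation of \<open>A\<^sub>M\<close>. A nonzero ideal \<open>I\<close> of an almost Dedekind domain is
  determined by its values \<open>v\<^sub>M(I)\<close>, products of ideals add values, and radical ideals are those
  with values at most \<open>1\<close>.

  (d) implies (a): off the finite set \<open>V\<^sub>2(H)\<close>, a clean ideal \<open>H\<close> at \<open>M\<close> has values at most \<open>1\<close>.
  Comparing \<open>I\<close> with a power of \<open>H\<close> shows that \<open>N \<mapsto> v\<^sub>N(I)\<close> is upper semicontinuous at \<open>M\<close>, hence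
  bounded, and \<open>I\<close> is the product of the intersections of the closed sets \<open>V\<^sub>n(I)\<close>.

  (b) implies (c): \<open>M\<close> is the only accumulation point of \<open>V(H)\<close>. If \<open>V\<^sub>2(H)\<close> is infinite, split it into
  two infinite sets \<open>S\<close> and \<open>T\<close>, and let \<open>I\<close> consist of the elements with values at least \<open>2\<close> on \<open>S\<close>.
  In a factorization \<open>I = J Q\<^sub>1 \<cdots> Q\<^sub>n\<close>, if \<open>J \<subseteq> M\<close> then \<open>J\<close> agrees with \<open>H\<close> at almost all points
  of \<open>T\<close>, where \<open>I\<close> has value \<open>0\<close>; otherwise \<open>I\<close> has value at most \<open>1\<close> at almost all points of \<open>S\<close>.

  (c) implies (d): weak factorization forces every nonzero element to lie in finitely many
  noninvertible maximal ideals only, and this yields a two-generated clean ideal in each of them.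
\<close>

section \<open>Ideals of a domain inside its quotient field\<close>

lemma ring_on_simps [simp]:
  "carrier (ring_on A) = A" "\<zero>\<^bsub>ring_on A\<^esub> = 0" "\<one>\<^bsub>ring_on A\<^esub> = 1"
  "x \<oplus>\<^bsub>ring_on A\<^esub> y = x + y" "x \<otimes>\<^bsub>ring_on A\<^esub> y = x * y"
  by (simp_all add: ring_on_def cring_class_ops_def)

text \<open>\<open>ideal_prod\<close> consults only the sum and product of its structure, never the
  carrier. So the product with a fractional ideal in \<open>invertible_ideal\<close> can be handled
  by the rules for \<open>ring_on A\<close>.\<close>

lemma ideal_prod_cring_class_ops:
  "ideal_prod cring_class_ops I J = ideal_prod (ring_on A) I J"
proof -
  have "x \<in> ideal_prod (ring_on A) I J" if "x \<in> ideal_prod cring_class_ops I J" for x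
    using that
  proof (induction rule: ideal_prod.induct)
    case (prod i j)
    then show ?case using ideal_prod.prod[of i I j J "ring_on A"] by (simp add: times_class)
  next
    case (sum s t)
    then show ?case using ideal_prod.sum[of s "ring_on A" I J t] by (simp add: plus_class)
  qed
  moreover have "x \<in> ideal_prod cring_class_ops I J" if "x \<in> ideal_prod (ring_on A) I J" for x
    using that
  proof (induction rule: ideal_prod.induct)
    case (prod i j)
    then show ?case using ideal_prod.prod[of i I j J cring_class_ops] by (simp add: times_class)
  next
    case (sum s t)
    then show ?case using ideal_prod.sum[of s cring_class_ops I J t] by (simp add: plus_class)
  qed
  ultimately show ?thesis by blast
qed

lemma ideal_prod_mult: "x \<in> I \<Longrightarrow> y \<in> J \<Longrightarrow> x * y \<in> ideal_prod (ring_on A) I J"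
  using ideal_prod.prod[of x I y J "ring_on A"] by simp

lemma ideal_prod_add:
  "x \<in> ideal_prod (ring_on A) I J \<Longrightarrow> y \<in> ideal_prod (ring_on A) I J \<Longrightarrow>
    x + y \<in> ideal_prod (ring_on A) I J"
  using ideal_prod.sum[of x "ring_on A" I J y] by simp

lemma ideal_prod_induct [consumes 1, case_names mult add]:
  assumes "x \<in> ideal_prod (ring_on A) I J"
    and "\<And>i j. i \<in> I \<Longrightarrow> j \<in> J \<Longrightarrow> P (i * j)"
    and "\<And>s t. P s \<Longrightarrow> P t \<Longrightarrow> P (s + t)"
  shows "P x"
  using assms(1) by (induction rule: ideal_prod.induct) (use assms(2,3) in auto)

lemma ideal_prod_subset:
  assumes "\<And>i j. i \<in> I \<Longrightarrow> j \<in> J \<Longrightarrow> i * j \<in> K"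
    and "\<And>s t. s \<in> K \<Longrightarrow> t \<in> K \<Longrightarrow> s + t \<in> K"
  shows "ideal_prod (ring_on A) I J \<subseteq> K"
proof
  fix x assume "x \<in> ideal_prod (ring_on A) I J"
  then show "x \<in> K" by (induction rule: ideal_prod_induct) (use assms in auto)
qed

locale domain_in_field =
  fixes A :: "'k::field set"
  assumes quotients: "domain_with_quotient_field A"
begin

sublocale A: domain "ring_on A"
  using quotients by (simp add: domain_with_quotient_field_def)

lemma zero_in [simp]: "0 \<in> A"
  using A.zero_closed by simp

lemma one_in [simp]: "1 \<in> A"
  using A.one_closed by simp

lemma add_in [intro]: "x \<in> A \<Longrightarrow> y \<in> A \<Longrightarrow> x + y \<in> A"
  using A.a_closed by simp

lemma mult_in [intro]: "x \<in> A \<Longrightarrow> y \<in> A \<Longrightarrow> x * y \<in> A"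
  using A.m_closed by simp

lemma uminus_in [intro]:
  assumes "x \<in> A" shows "- x \<in> A"
proof -
  have "\<ominus>\<^bsub>ring_on A\<^esub> x \<in> A" "x + \<ominus>\<^bsub>ring_on A\<^esub> x = 0"
    using assms A.a_inv_closed[of x] A.r_neg[of x] by simp_all
  then show ?thesis by (metis minus_unique)
qed

lemma diff_in [intro]: "x \<in> A \<Longrightarrow> y \<in> A \<Longrightarrow> x - y \<in> A"
  using add_in[of x "- y"] uminus_in[of y] by simp

lemma power_in [intro]: "x \<in> A \<Longrightarrow> x ^ n \<in> A"
  by (induction n) auto

lemma prod_in [intro]: "(\<And>i. i \<in> S \<Longrightarrow> f i \<in> A) \<Longrightarrow> prod f S \<in> A"
  by (induction S rule: infinite_finite_induct) auto

lemma ideal_iff: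
  "ideal I (ring_on A) \<longleftrightarrow>
    I \<subseteq> A \<and> 0 \<in> I \<and> (\<forall>x\<in>I. \<forall>y\<in>I. x + y \<in> I) \<and> (\<forall>x\<in>A. \<forall>y\<in>I. x * y \<in> I)" (is "_ \<longleftrightarrow> ?R")
proof
  assume "ideal I (ring_on A)"
  then interpret I: ideal I "ring_on A" .
  show ?R
    using I.I_l_closed I.a_subset I.zero_closed I.a_closed by auto
next
  assume R: ?R
  have inv: "\<ominus>\<^bsub>ring_on A\<^esub> x \<in> I" if "x \<in> I" for x
  proof -
    have "x \<in> A" using that R by blast
    then have "x + \<ominus>\<^bsub>ring_on A\<^esub> x = 0"
      using A.r_neg[of x] by simp
    then have "\<ominus>\<^bsub>ring_on A\<^esub> x = (- 1) * x" by (metis minus_unique mult_minus1)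
    then show ?thesis using R that by (metis one_in uminus_in)
  qed
  show "ideal I (ring_on A)"
  proof (rule idealI)
    show "subgroup I (add_monoid (ring_on A))"
    proof (rule A.add.subgroupI)
      show "I \<subseteq> carrier (ring_on A)" using R by simp
      show "I \<noteq> {}" using R by blast
    qed (use R inv in auto)
  next
    show "x \<otimes>\<^bsub>ring_on A\<^esub> a \<in> I" "a \<otimes>\<^bsub>ring_on A\<^esub> x \<in> I" 
      if "a \<in> I" "x \<in> carrier (ring_on A)" for a x
      using R that by (simp_all add: mult.commute[of a x])
  qed (rule A.ring_axioms)
qed

lemma idealI':
  assumes "I \<subseteq> A" "0 \<in> I" "\<And>x y. x \<in> I \<Longrightarrow> y \<in> I \<Longrightarrow> x + y \<in> I"
    "\<And>x y. x \<in> A \<Longrightarrow> y \<in> I \<Longrightarrow> x * y \<in> I"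
  shows "ideal I (ring_on A)"
  using assms by (simp add: ideal_iff)

lemma ideal_subset: "ideal I (ring_on A) \<Longrightarrow> I \<subseteq> A"
  and ideal_zero: "ideal I (ring_on A) \<Longrightarrow> 0 \<in> I"
  and ideal_add: "ideal I (ring_on A) \<Longrightarrow> x \<in> I \<Longrightarrow> y \<in> I \<Longrightarrow> x + y \<in> I"
  and ideal_mult: "ideal I (ring_on A) \<Longrightarrow> a \<in> A \<Longrightarrow> x \<in> I \<Longrightarrow> a * x \<in> I"
  by (simp_all add: ideal_iff)

lemma ideal_mult_right: "ideal I (ring_on A) \<Longrightarrow> a \<in> A \<Longrightarrow> x \<in> I \<Longrightarrow> x * a \<in> I"
  using ideal_mult[of I a x] by (simp add: mult.commute)

lemma ideal_diff: "ideal I (ring_on A) \<Longrightarrow> x \<in> I \<Longrightarrow> y \<in> I \<Longrightarrow> x - y \<in> I"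
  using ideal_add[of I x "- y"] ideal_mult[of I "- 1" y] uminus_in[OF one_in] by simp

lemma ideal_eq_ring: "ideal I (ring_on A) \<Longrightarrow> 1 \<in> I \<Longrightarrow> I = A"
  using ideal_mult[of I _ 1] ideal_subset[of I] by auto

lemma ideal_ring: "ideal A (ring_on A)"
  by (auto simp: ideal_iff)

lemma ideal_ideal_prod:
  assumes "ideal I (ring_on A)" "ideal J (ring_on A)"
  shows "ideal (ideal_prod (ring_on A) I J) (ring_on A)"
  using A.ideal_prod_is_ideal[OF assms] .

section \<open>Maximal ideals: primeness, avoidance and local tests\<close>

lemma max_idealsD:
  assumes "M \<in> max_ideals A"
  shows "ideal M (ring_on A)" "1 \<notin> M"
    "\<And>x y. x \<in> A \<Longrightarrow> y \<in> A \<Longrightarrow> x * y \<in> M \<Longrightarrow> x \<in> M \<or> y \<in> M"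
proof -
  interpret M: maximalideal M "ring_on A" using assms by (simp add: max_ideals_def)
  interpret P: primeideal M "ring_on A"
    using A.maximalideal_prime M.maximalideal_axioms by blast
  show "ideal M (ring_on A)" by (rule M.ideal_axioms)
  show "1 \<notin> M" using M.one_imp_carrier M.I_notcarr by auto
  show "x \<in> M \<or> y \<in> M" if "x \<in> A" "y \<in> A" "x * y \<in> M" for x y
    using P.I_prime[of x y] that by simp
qed

lemma max_ideal_maximal:
  "M \<in> max_ideals A \<Longrightarrow> ideal J (ring_on A) \<Longrightarrow> M \<subseteq> J \<Longrightarrow> J = M \<or> J = A"
  using maximalideal.I_maximal[of M "ring_on A" J] ideal_subset[of J]
  by (auto simp: max_ideals_def)

lemma max_ideals_eq: "M \<in> max_ideals A \<Longrightarrow> N \<in> max_ideals A \<Longrightarrow> M \<subseteq> N \<Longrightarrow> M = N"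
  using max_ideal_maximal[of M N] max_idealsD[of N] by auto

text \<open>Merges finitely many denominators outside \<open>M\<close> into one, that is, intersects
  basic neighbourhoods of \<open>M\<close>. For infinite \<open>S\<close> the product is
  \<open>1\<close>, which also lies outside \<open>M\<close>.\<close>

lemma max_ideal_prod_notin:
  assumes "M \<in> max_ideals A" "\<And>i. i \<in> S \<Longrightarrow> f i \<in> A - M"
  shows "prod f S \<in> A - M"
  using assms(2)
proof (induction S rule: infinite_finite_induct)
  case (insert i S)
  then have "f i \<in> A - M" "prod f S \<in> A - M" by simp_all
  then have "f i * prod f S \<in> A - M" using max_idealsD(3)[OF assms(1)] by blast
  then show ?case using insert.hyps by simp
qed (use max_idealsD(2)[OF assms(1)] in simp_all)

lemma max_ideal_power_memD:
  assumes "M \<in> max_ideals A" "x \<in> A" "x ^ n \<in> M"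
  shows "x \<in> M"
  using max_ideal_prod_notin[of M "{..<n}" "\<lambda>_. x"] assms by auto

lemma prod_in_ideal:
  assumes "ideal I (ring_on A)" "finite S" "i \<in> S" "f i \<in> I" "\<And>i. i \<in> S \<Longrightarrow> f i \<in> A"
  shows "prod f S \<in> I"
  using assms ideal_mult[of I "prod f (S - {i})" "f i"] 
  by (auto simp: prod.remove[of S i f] mult.commute intro!: prod_in)

text \<open>Avoidance one ideal at a time: if the \<open>x\<close> found so far lies in the new
  \<open>N\<close>, it is corrected by a product \<open>w\<close> of elements of \<open>M\<close>
  and of the earlier ideals, all chosen outside \<open>N\<close>. This changes \<open>x\<close>
  modulo \<open>N\<close> but not modulo \<open>M\<close> or the earlier ideals.\<close>

lemma max_ideal_avoidance:
  assumes M: "M \<in> max_ideals A" and "finite T" "\<And>N. N \<in> T \<Longrightarrow> N \<in> max_ideals A \<and> N \<noteq> M"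
  obtains x where "x \<in> M" "\<And>N. N \<in> T \<Longrightarrow> x \<notin> N"
proof -
  have "\<exists>x\<in>M. \<forall>N\<in>T. x \<notin> N" using assms(2,3)
  proof (induction T rule: finite_induct)
    case empty
    then show ?case using ideal_zero[OF max_idealsD(1)[OF M]] by blast
  next
    case (insert N T)
    then obtain x where x: "x \<in> M" "\<And>P. P \<in> T \<Longrightarrow> x \<notin> P" by blast
    have N: "N \<in> max_ideals A" using insert.prems by blast
    note idN = max_idealsD(1)[OF N]
    show ?case
    proof (cases "x \<in> N")
      case False
      then show ?thesis using x by blast
    next
      case True
      have max: "P \<in> max_ideals A" "P \<noteq> N" if "P \<in> insert M T" for P
        using that insert.prems insert.hyps M by blast+
      have "\<exists>y. y \<in> P \<and> y \<in> A - N" if "P \<in> insert M T" for P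
        using max_ideals_eq[OF max(1)[OF that] N] max(2)[OF that] 
          ideal_subset[OF max_idealsD(1)[OF max(1)[OF that]]] by blast
      then obtain y where y: "\<And>P. P \<in> insert M T \<Longrightarrow> y P \<in> P" "\<And>P. P \<in> insert M T \<Longrightarrow> y P \<in> A - N"
        by metis
      define w where "w = prod y (insert M T)"
      have "w \<in> A - N" unfolding w_def by (rule max_ideal_prod_notin[OF N y(2)])
      have w: "w \<in> P" if "P \<in> insert M T" for P
        unfolding w_def
        using prod_in_ideal[where f = y, OF max_idealsD(1)[OF max(1)[OF that]] _ that y(1)[OF that]]
          insert.hyps(1) y(2) by blast
      have "x + w \<in> M" using ideal_add[OF max_idealsD(1)[OF M] x(1)] w by blast
      moreover have "x + w \<notin> N"
        using ideal_diff[OF idN, of "x + w" x] True \<open>w \<in> A - N\<close> by auto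
      moreover have "x + w \<notin> P" if "P \<in> T" for P
        using ideal_diff[OF max_idealsD(1)[OF max(1)], of P "x + w" w] w[of P] x(2)[OF that] that by auto
      ultimately show ?thesis by blast
    qed
  qed
  then show thesis using that by blast
qed

lemma exists_max_ideal:
  assumes "ideal I (ring_on A)" "I \<noteq> A"
  obtains M where "M \<in> max_ideals A" "I \<subseteq> M"
proof -
  \<comment> \<open>Properness is expressed as \<open>1 \<notin> J\<close>, a condition that visibly
    passes to unions of chains.\<close>
  define \<C> where "\<C> = {J. ideal J (ring_on A) \<and> I \<subseteq> J \<and> 1 \<notin> J}"
  have "\<C> \<noteq> {}" using assms ideal_eq_ring unfolding \<C>_def by blast
  moreover have Un: "\<Union>C \<in> \<C>" if C: "C \<noteq> {}" "subset.chain \<C> C" for C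
  proof -
    have sub: "ideal J (ring_on A)" "I \<subseteq> J" "1 \<notin> J" if "J \<in> C" for J
      using C that by (auto simp: subset_chain_def \<C>_def)
    have "ideal (\<Union>C) (ring_on A)"
    proof (rule idealI')
      show "\<Union>C \<subseteq> A" using sub ideal_subset by blast
      show "0 \<in> \<Union>C" using C(1) sub ideal_zero by blast
      show "x + y \<in> \<Union>C" if xy: "x \<in> \<Union>C" "y \<in> \<Union>C" for x y
      proof -
        obtain J J' where J: "J \<in> C" "J' \<in> C" "x \<in> J" "y \<in> J'" using xy by blast
        then have "J \<subseteq> J' \<or> J' \<subseteq> J" using C by (auto simp: subset_chain_def)
        then show ?thesis using J sub(1) ideal_add by (metis UnionI subsetD)
      qed
      show "x * y \<in> \<Union>C" if "x \<in> A" "y \<in> \<Union>C" for x y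
        using that sub ideal_mult by blast
    qed
    then show ?thesis using sub C(1) unfolding \<C>_def by blast
  qed
  ultimately have "\<exists>M\<in>\<C>. \<forall>J\<in>\<C>. M \<subseteq> J \<longrightarrow> J = M"
    by (rule subset_Zorn_nonempty)
  then obtain M where "M \<in> \<C>" and max: "\<And>J. J \<in> \<C> \<Longrightarrow> M \<subseteq> J \<Longrightarrow> J = M"
    by blast
  then have M: "ideal M (ring_on A)" "I \<subseteq> M" "1 \<notin> M"
    by (simp_all add: \<C>_def)
  have "maximalideal M (ring_on A)"
  proof (rule maximalidealI)
    show "carrier (ring_on A) \<noteq> M" using M(3) one_in by auto
    show "J = M \<or> J = carrier (ring_on A)" if J: "ideal J (ring_on A)" "M \<subseteq> J" for J
    proof (cases "1 \<in> J")
      case True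
      then show ?thesis using ideal_eq_ring[OF J(1)] by simp
    next
      case False
      then have "J \<in> \<C>" using M J by (simp add: \<C>_def)
      then show ?thesis using max J by blast
    qed
  qed (rule M(1))
  then show thesis using that[of M] M(2) by (simp add: max_ideals_def)
qed

text \<open>This serves as compactness of the maximal spectrum: if the elements with some property
  form an ideal and each maximal ideal omits one of them, then \<open>1\<close> has the
  property.\<close>

lemma ideal_eq_ringI:
  assumes "ideal I (ring_on A)" "\<And>M. M \<in> max_ideals A \<Longrightarrow> \<exists>x\<in>I. x \<notin> M"
  shows "I = A"
proof (rule ccontr)
  assume "I \<noteq> A"
  then obtain M where "M \<in> max_ideals A" "I \<subseteq> M"
    by (rule exists_max_ideal[OF assms(1)])
  then show False using assms(2) by blast
qed

text \<open>The colon ideal \<open>(I : x)\<close> equals \<open>A\<close> as soon as it does so locally.\<close>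

lemma mem_ideal_local:
  assumes "ideal I (ring_on A)" "\<And>M. M \<in> max_ideals A \<Longrightarrow> \<exists>s\<in>A - M. s * x \<in> I"
  shows "x \<in> I"
proof -
  let ?J = "{s \<in> A. s * x \<in> I}"
  have "ideal ?J (ring_on A)"
    using assms(1) unfolding ideal_iff by (auto simp: distrib_right mult.assoc add_in mult_in)
  then have "?J = A" by (rule ideal_eq_ringI) (use assms(2) in blast)
  then have "1 \<in> ?J" using one_in by blast
  then show ?thesis by simp
qed

end

section \<open>Valuations of ideals in almost Dedekind domains\<close>

locale almost_dedekind_domain =
  fixes A :: "'k::field set"
  assumes almost_dedekind: "almost_dedekind A"

sublocale almost_dedekind_domain \<subseteq> domain_in_field
  using almost_dedekind by unfold_locales (simp add: almost_dedekind_def)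

context almost_dedekind_domain
begin

section \<open>The normalized valuation at a maximal ideal\<close>

definition val :: "'k set \<Rightarrow> 'k \<Rightarrow> int" where
  "val M = (SOME v. discrete_valuation v \<and> localization A M = {x. x = 0 \<or> 0 \<le> v x})"

text \<open>For maximal \<open>M\<close>, the fractional ideal of the localization generated by the
  n-th power of a uniformizer. The element \<open>0\<close> is added by hand because
  \<open>val M 0\<close> is arbitrary.\<close>

definition val_ge :: "'k set \<Rightarrow> int \<Rightarrow> 'k set" where
  "val_ge M n = {x. x = 0 \<or> n \<le> val M x}"

lemma val_spec:
  assumes "M \<in> max_ideals A"
  shows discrete_valuation_val: "discrete_valuation (val M)"
    and localization_eq: "localization A M = val_ge M 0"
proof -
  have "\<exists>v. discrete_valuation v \<and> localization A M = {x. x = 0 \<or> 0 \<le> v x}"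
    using assms almost_dedekind by (simp add: almost_dedekind_def is_DVR_def)
  then have "discrete_valuation (val M) \<and> localization A M = {x. x = 0 \<or> 0 \<le> val M x}"
    unfolding val_def by (rule someI_ex)
  then show "discrete_valuation (val M)" "localization A M = val_ge M 0"
    by (simp_all add: val_ge_def)
qed

lemma val_mult:
  "M \<in> max_ideals A \<Longrightarrow> x \<noteq> 0 \<Longrightarrow> y \<noteq> 0 \<Longrightarrow> val M (x * y) = val M x + val M y"
  using discrete_valuation_val unfolding discrete_valuation_def by blast

lemma val_add:
  "M \<in> max_ideals A \<Longrightarrow> x \<noteq> 0 \<Longrightarrow> y \<noteq> 0 \<Longrightarrow> x + y \<noteq> 0 \<Longrightarrow> min (val M x) (val M y) \<le> val M (x + y)"
  using discrete_valuation_val unfolding discrete_valuation_def by blast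

lemma val_one: "M \<in> max_ideals A \<Longrightarrow> val M 1 = 0"
  using val_mult[of M 1 1] by simp

lemma val_divide: "M \<in> max_ideals A \<Longrightarrow> x \<noteq> 0 \<Longrightarrow> y \<noteq> 0 \<Longrightarrow> val M (x / y) = val M x - val M y"
  using val_mult[of M "x / y" y] by simp

lemma val_power: "M \<in> max_ideals A \<Longrightarrow> x \<noteq> 0 \<Longrightarrow> val M (x ^ n) = int n * val M x"
  by (induction n) (simp_all add: val_one val_mult algebra_simps)

lemma val_ge_add:
  assumes "M \<in> max_ideals A" "x \<in> val_ge M n" "y \<in> val_ge M n"
  shows "x + y \<in> val_ge M n"
  using assms val_add[of M x y] unfolding val_ge_def by (cases "x = 0"; cases "y = 0") auto

lemma val_ge_mult:
  assumes "M \<in> max_ideals A" "x \<in> val_ge M m" "y \<in> val_ge M n"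
  shows "x * y \<in> val_ge M (m + n)"
  using assms val_mult[of M x y] unfolding val_ge_def by (cases "x = 0"; cases "y = 0") auto

text \<open>The passage from a point to a neighbourhood: integrality at \<open>M\<close> becomes
  membership in \<open>A\<close> after multiplication by some \<open>s\<close> outside
  \<open>M\<close>, so it also holds at every maximal ideal that omits \<open>s\<close>.\<close>

lemma val_denominator:
  assumes "M \<in> max_ideals A" "x \<in> val_ge M 0"
  obtains s where "s \<in> A" "s \<notin> M" "s * x \<in> A"
proof -
  obtain a b where "x = a / b" "a \<in> A" "b \<in> A - M"
    using assms localization_eq unfolding localization_def by blast
  then have "b \<in> A" "b \<notin> M" "b * x \<in> A"
    using ideal_zero[OF max_idealsD(1)[OF assms(1)]] by auto
  then show thesis by (rule that)
qed

lemma val_nonneg: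
  assumes "M \<in> max_ideals A" "x \<in> A"
  shows "x \<in> val_ge M 0"
proof -
  have "x = x / 1 \<and> x \<in> A \<and> 1 \<in> A - M"
    using assms max_idealsD(2) by simp
  then have "x \<in> localization A M" unfolding localization_def by blast
  then show ?thesis using localization_eq[OF assms(1)] by simp
qed

text \<open>A nonzero \<open>x\<close> in \<open>A\<close> lies outside \<open>M\<close> exactly
  when it is a unit of the localization, that is, when \<open>1 / x\<close> has nonnegative
  value.\<close>

lemma mem_max_ideal_iff:
  assumes M: "M \<in> max_ideals A" and x: "x \<in> A"
  shows "x \<in> M \<longleftrightarrow> x \<in> val_ge M 1"
proof (cases "x = 0")
  case True
  then show ?thesis using ideal_zero[OF max_idealsD(1)[OF M]] by (simp add: val_ge_def)
next
  case False
  have "x \<in> M \<longleftrightarrow> 1 / x \<notin> val_ge M 0"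
  proof
    assume "x \<in> M"
    show "1 / x \<notin> val_ge M 0"
    proof
      assume "1 / x \<in> val_ge M 0"
      then obtain s where s: "s \<in> A" "s \<notin> M" "s * (1 / x) \<in> A"
        by (rule val_denominator[OF M])
      then have "s * (1 / x) * x \<in> M"
        using \<open>x \<in> M\<close> ideal_mult[OF max_idealsD(1)[OF M]] by blast
      then show False using False s by simp
    qed
  next
    assume *: "1 / x \<notin> val_ge M 0"
    show "x \<in> M"
    proof (rule ccontr)
      assume "x \<notin> M"
      then have "1 / x = 1 / x \<and> 1 \<in> A \<and> x \<in> A - M" using x by simp
      then have "1 / x \<in> localization A M" unfolding localization_def by blast
      then show False using * localization_eq[OF M] by simp
    qed
  qed
  also have "\<dots> \<longleftrightarrow> x \<in> val_ge M 1"
    using False M val_divide[OF M, of 1 x] val_one[OF M] by (auto simp: val_ge_def)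
  finally show ?thesis .
qed

lemma val_eq_0:
  assumes "M \<in> max_ideals A" "x \<in> A" "x \<notin> M"
  shows "val M x = 0" "x \<noteq> 0"
  using assms mem_max_ideal_iff[of M x] val_nonneg[of M x] by (auto simp: val_ge_def)

lemma uniformizer:
  assumes M: "M \<in> max_ideals A"
  obtains p where "p \<in> A" "p \<noteq> 0" "val M p = 1"
proof -
  obtain x where x: "x \<noteq> 0" "val M x = 1"
    using discrete_valuation_val[OF M] unfolding discrete_valuation_def
    by (metis Compl_iff UNIV_I imageE insertI1)
  then have "x \<in> val_ge M 0" by (simp add: val_ge_def)
  then obtain s where s: "s \<in> A" "s \<notin> M" "s * x \<in> A"
    by (rule val_denominator[OF M])
  then have "s * x \<noteq> 0" "val M (s * x) = 1"
    using val_eq_0[OF M, of s] x val_mult[OF M, of s x] by simp_all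
  with s show thesis by (intro that)
qed

text \<open>\<open>A\<close> is the intersection of its localizations; this is
  \<open>mem_ideal_local\<close> for the unit ideal.\<close>

lemma mem_ringI:
  assumes "\<And>M. M \<in> max_ideals A \<Longrightarrow> x \<in> val_ge M 0"
  shows "x \<in> A"
proof (rule mem_ideal_local[OF ideal_ring])
  show "\<exists>s\<in>A - M. s * x \<in> A" if "M \<in> max_ideals A" for M
    using val_denominator[OF that assms[OF that]] by blast
qed

section \<open>Values of ideals and the local comparison of ideals\<close>

definition nonzero_ideal :: "'k set \<Rightarrow> bool" where
  "nonzero_ideal I \<longleftrightarrow> ideal I (ring_on A) \<and> I \<noteq> {0}"

text \<open>The exponent of the power of the maximal ideal that \<open>I\<close> generates in the
  localization at \<open>M\<close>. It can be a natural number because elements of \<open>A\<close>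
  have nonnegative values; for \<open>I = {0}\<close> it is unspecified, hence the hypothesis
  \<open>nonzero_ideal\<close> below.\<close>

definition ideal_val :: "'k set \<Rightarrow> 'k set \<Rightarrow> nat" where
  "ideal_val M I = (LEAST n. \<exists>x\<in>I. x \<noteq> 0 \<and> val M x = int n)"

lemma nonzero_idealD:
  assumes "nonzero_ideal I"
  shows "ideal I (ring_on A)" "I \<subseteq> A" "\<exists>x\<in>I. x \<noteq> 0"
  using assms ideal_subset[of I] ideal_zero[of I] unfolding nonzero_ideal_def by blast+

lemma nonzero_idealI:
  "ideal I (ring_on A) \<Longrightarrow> x \<in> I \<Longrightarrow> x \<noteq> 0 \<Longrightarrow> nonzero_ideal I"
  by (auto simp: nonzero_ideal_def)

lemma ideal_val_attained:
  assumes M: "M \<in> max_ideals A" and I: "nonzero_ideal I"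
  obtains x where "x \<in> I" "x \<noteq> 0" "val M x = int (ideal_val M I)"
proof -
  obtain x where "x \<in> I" "x \<noteq> 0" using nonzero_idealD[OF I] by blast
  moreover from this have "0 \<le> val M x"
    using nonzero_idealD(2)[OF I] val_nonneg[OF M, of x] by (auto simp: val_ge_def)
  ultimately have "\<exists>n. \<exists>x\<in>I. x \<noteq> 0 \<and> val M x = int n"
    by (metis nonneg_int_cases)
  from LeastI_ex[OF this] show thesis using that unfolding ideal_val_def by blast
qed

lemma ideal_val_le:
  assumes M: "M \<in> max_ideals A" and I: "nonzero_ideal I" and x: "x \<in> I" "x \<noteq> 0"
  shows "int (ideal_val M I) \<le> val M x"
proof -
  have "0 \<le> val M x"
    using x nonzero_idealD(2)[OF I] val_nonneg[OF M, of x] by (auto simp: val_ge_def)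
  then obtain n where n: "val M x = int n" by (metis nonneg_int_cases)
  then have "ideal_val M I \<le> n"
    unfolding ideal_val_def using x by (intro Least_le) blast
  with n show ?thesis by simp
qed

lemma subset_val_ge_iff:
  assumes "M \<in> max_ideals A" "nonzero_ideal I"
  shows "I \<subseteq> val_ge M n \<longleftrightarrow> n \<le> int (ideal_val M I)"
proof
  assume "I \<subseteq> val_ge M n"
  moreover obtain x where "x \<in> I" "x \<noteq> 0" "val M x = int (ideal_val M I)"
    by (rule ideal_val_attained[OF assms])
  ultimately show "n \<le> int (ideal_val M I)" by (auto simp: val_ge_def)
next
  assume "n \<le> int (ideal_val M I)"
  then show "I \<subseteq> val_ge M n"
    using ideal_val_le[OF assms] unfolding val_ge_def by force
qed

lemma subset_max_ideal_iff:
  assumes "M \<in> max_ideals A" "nonzero_ideal I"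
  shows "I \<subseteq> M \<longleftrightarrow> 1 \<le> ideal_val M I"
proof -
  have "I \<subseteq> M \<longleftrightarrow> I \<subseteq> val_ge M 1"
    using mem_max_ideal_iff[OF assms(1)] nonzero_idealD(2)[OF assms(2)] by blast
  then show ?thesis using subset_val_ge_iff[OF assms, of 1] by simp
qed

lemma ideal_val_antimono:
  assumes "M \<in> max_ideals A" "nonzero_ideal I" "nonzero_ideal J" "I \<subseteq> J"
  shows "ideal_val M J \<le> ideal_val M I"
  using subset_val_ge_iff[OF assms(1,2), of "int (ideal_val M J)"]
    subset_val_ge_iff[OF assms(1,3), of "int (ideal_val M J)"] assms(4) by auto

lemma nonzero_ideal_ring: "nonzero_ideal A"
  using nonzero_idealI[OF ideal_ring one_in] by simp

lemma ideal_val_ring: "M \<in> max_ideals A \<Longrightarrow> ideal_val M A = 0"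
  using ideal_val_le[OF _ nonzero_ideal_ring one_in] val_one by fastforce

lemma nonzero_ideal_prod:
  assumes "nonzero_ideal I" "nonzero_ideal J"
  shows "nonzero_ideal (ideal_prod (ring_on A) I J)"
proof -
  obtain x y where "x \<in> I" "x \<noteq> 0" "y \<in> J" "y \<noteq> 0" using assms nonzero_idealD(3) by metis
  then show ?thesis
    using nonzero_idealI[OF ideal_ideal_prod ideal_prod_mult, of I J x y] assms nonzero_idealD(1)
    by simp
qed

lemma ideal_val_prod:
  assumes M: "M \<in> max_ideals A" and IJ: "nonzero_ideal I" "nonzero_ideal J"
  shows "ideal_val M (ideal_prod (ring_on A) I J) = ideal_val M I + ideal_val M J"
proof (rule antisym)
  obtain x y where x: "x \<in> I" "x \<noteq> 0" "val M x = int (ideal_val M I)"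
    and y: "y \<in> J" "y \<noteq> 0" "val M y = int (ideal_val M J)"
    using ideal_val_attained[OF M] IJ by metis
  show "ideal_val M (ideal_prod (ring_on A) I J) \<le> ideal_val M I + ideal_val M J"
    using ideal_val_le[OF M nonzero_ideal_prod[OF IJ] ideal_prod_mult[OF x(1) y(1)]]
      x y val_mult[OF M x(2) y(2)] by simp
  have "ideal_prod (ring_on A) I J \<subseteq> val_ge M (int (ideal_val M I) + int (ideal_val M J))"
  proof (rule ideal_prod_subset)
    show "i * j \<in> val_ge M (int (ideal_val M I) + int (ideal_val M J))" 
      if "i \<in> I" "j \<in> J" for i j
    proof (rule val_ge_mult[OF M])
      show "i \<in> val_ge M (int (ideal_val M I))"
        using subset_val_ge_iff[OF M IJ(1)] that by blast
      show "j \<in> val_ge M (int (ideal_val M J))"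
        using subset_val_ge_iff[OF M IJ(2)] that by blast
    qed
  qed (rule val_ge_add[OF M])
  then show "ideal_val M I + ideal_val M J \<le> ideal_val M (ideal_prod (ring_on A) I J)"
    using subset_val_ge_iff[OF M nonzero_ideal_prod[OF IJ]] by simp
qed

text \<open>Containment is a local property. At \<open>M\<close>, an element \<open>a\<close> of
  \<open>J\<close> of least value divides \<open>x\<close> in the localization, so some
  \<open>s\<close> outside \<open>M\<close> brings \<open>s * x\<close> into
  \<open>J\<close>.\<close>

lemma ideal_subset_iff:
  assumes "nonzero_ideal I" "nonzero_ideal J"
  shows "I \<subseteq> J \<longleftrightarrow> (\<forall>M\<in>max_ideals A. ideal_val M J \<le> ideal_val M I)"
proof (intro iffI subsetI)
  fix x assume val: "\<forall>M\<in>max_ideals A. ideal_val M J \<le> ideal_val M I" and x: "x \<in> I"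
  have J: "ideal J (ring_on A)" using assms nonzero_idealD by blast
  show "x \<in> J"
  proof (cases "x = 0")
    case False
    show ?thesis
    proof (rule mem_ideal_local[OF J])
      fix M assume M: "M \<in> max_ideals A"
      obtain a where a: "a \<in> J" "a \<noteq> 0" "val M a = int (ideal_val M J)"
        by (rule ideal_val_attained[OF M assms(2)])
      have "int (ideal_val M J) \<le> val M x"
        using ideal_val_le[OF M assms(1) x False] val M by fastforce
      then have "x / a \<in> val_ge M 0"
        using a False val_divide[OF M False a(2)] by (simp add: val_ge_def)
      then obtain s where s: "s \<in> A" "s \<notin> M" "s * (x / a) \<in> A"
        by (rule val_denominator[OF M])
      then have "s * (x / a) * a \<in> J" using ideal_mult[OF J] a(1) by blast
      then show "\<exists>s\<in>A - M. s * x \<in> J" using s a(2) by auto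
    qed
  qed (use ideal_zero[OF J] in simp)
qed (use ideal_val_antimono assms in blast)

lemma ideal_eqI:
  assumes "nonzero_ideal I" "nonzero_ideal J" "\<And>M. M \<in> max_ideals A \<Longrightarrow> ideal_val M I = ideal_val M J"
  shows "I = J"
  using ideal_subset_iff[OF assms(1,2)] ideal_subset_iff[OF assms(2,1)] assms(3) by auto

section \<open>Values of finite products and powers\<close>

lemma ideal_list_prod_simps:
  "ideal_list_prod A [] = A"
  "ideal_list_prod A (I # Is) = ideal_prod (ring_on A) I (ideal_list_prod A Is)"
  by (simp_all add: ideal_list_prod_def)

lemma nonzero_ideal_list_prod:
  "(\<And>I. I \<in> set Is \<Longrightarrow> nonzero_ideal I) \<Longrightarrow> nonzero_ideal (ideal_list_prod A Is)"
  by (induction Is) (simp_all add: ideal_list_prod_simps nonzero_ideal_ring nonzero_ideal_prod)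

lemma ideal_val_list_prod:
  "M \<in> max_ideals A \<Longrightarrow> (\<And>I. I \<in> set Is \<Longrightarrow> nonzero_ideal I) \<Longrightarrow>
    ideal_val M (ideal_list_prod A Is) = (\<Sum>I\<leftarrow>Is. ideal_val M I)"
  by (induction Is)
    (simp_all add: ideal_list_prod_simps ideal_val_ring ideal_val_prod nonzero_ideal_list_prod)

text \<open>Stated for arbitrary ideals, so that it applies before values make sense: the factors of
  a nonzero ideal contain it and are therefore nonzero.\<close>

lemma ideal_list_prod_subset:
  assumes "\<And>I. I \<in> set Is \<Longrightarrow> ideal I (ring_on A)"
  shows "ideal (ideal_list_prod A Is) (ring_on A)" "I \<in> set Is \<Longrightarrow> ideal_list_prod A Is \<subseteq> I"
proof -
  have "ideal (ideal_list_prod A Is) (ring_on A) \<and> (\<forall>I\<in>set Is. ideal_list_prod A Is \<subseteq> I)"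
    using assms
  proof (induction Is)
    case Nil
    then show ?case by (simp add: ideal_list_prod_simps ideal_ring)
  next
    case (Cons J Is)
    then have J: "ideal J (ring_on A)" and Is: "ideal (ideal_list_prod A Is) (ring_on A)"
      and sub: "\<forall>I\<in>set Is. ideal_list_prod A Is \<subseteq> I"
      by simp_all
    have "ideal_list_prod A (J # Is) \<subseteq> J \<inter> ideal_list_prod A Is"
      using A.ideal_prod_inter[OF J Is] by (simp add: ideal_list_prod_simps)
    moreover have "ideal (ideal_list_prod A (J # Is)) (ring_on A)"
      using ideal_ideal_prod[OF J Is] by (simp add: ideal_list_prod_simps)
    ultimately show ?case using sub by (simp, blast)
  qed
  then show "ideal (ideal_list_prod A Is) (ring_on A)" "I \<in> set Is \<Longrightarrow> ideal_list_prod A Is \<subseteq> I"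
    by blast+
qed

lemma nonzero_ideal_max:
  assumes M: "M \<in> max_ideals A"
  shows "nonzero_ideal M"
proof -
  obtain p where "p \<in> A" "p \<noteq> 0" "val M p = 1" by (rule uniformizer[OF M])
  then have "p \<in> M" using mem_max_ideal_iff[OF M] by (simp add: val_ge_def)
  then show ?thesis using nonzero_idealI[OF max_idealsD(1)[OF M]] \<open>p \<noteq> 0\<close> by blast
qed

lemma ideal_val_max:
  assumes M: "M \<in> max_ideals A" and N: "N \<in> max_ideals A"
  shows "ideal_val N M = (if N = M then 1 else 0)"
proof (cases "N = M")
  case True
  obtain p where p: "p \<in> A" "p \<noteq> 0" "val M p = 1" by (rule uniformizer[OF M])
  then have "p \<in> M" using mem_max_ideal_iff[OF M] by (simp add: val_ge_def)
  then have "ideal_val M M \<le> 1"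
    using ideal_val_le[OF M nonzero_ideal_max[OF M]] p by fastforce
  then show ?thesis using True subset_max_ideal_iff[OF M nonzero_ideal_max[OF M]] by simp
next
  case False
  then have "\<not> M \<subseteq> N" using max_ideals_eq[OF M N] by blast
  then show ?thesis using False subset_max_ideal_iff[OF N nonzero_ideal_max[OF M]] by simp
qed

lemma ideal_power_simps:
  "ideal_power A I 0 = A"
  "ideal_power A I (Suc n) = ideal_prod (ring_on A) (ideal_power A I n) I"
  by (simp_all add: ideal_power_def nat_pow_def ideals_set_def)

lemma nonzero_ideal_power: "nonzero_ideal I \<Longrightarrow> nonzero_ideal (ideal_power A I n)"
  by (induction n) (simp_all add: ideal_power_simps nonzero_ideal_ring nonzero_ideal_prod)

lemma ideal_val_power:
  "M \<in> max_ideals A \<Longrightarrow> nonzero_ideal I \<Longrightarrow> ideal_val M (ideal_power A I n) = n * ideal_val M I"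
  by (induction n)
    (simp_all add: ideal_power_simps ideal_val_ring nonzero_ideal_power ideal_val_prod)

lemma subset_max_power_iff:
  assumes M: "M \<in> max_ideals A" and I: "nonzero_ideal I"
  shows "I \<subseteq> ideal_power A M n \<longleftrightarrow> n \<le> ideal_val M I"
  using M by (auto simp: ideal_subset_iff[OF I nonzero_ideal_power[OF nonzero_ideal_max[OF M]]]
      ideal_val_power nonzero_ideal_max ideal_val_max)

lemma V_set_eq: "nonzero_ideal I \<Longrightarrow> V_set A n I = {M \<in> max_ideals A. n \<le> ideal_val M I}"
  using subset_max_power_iff by (auto simp: V_set_def)

section \<open>Inverses of ideals and invertibility\<close>

lemma frac_inverse_mult: "x \<in> frac_inverse A I \<Longrightarrow> i \<in> I \<Longrightarrow> x * i \<in> A"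
  by (simp add: frac_inverse_def)

lemma frac_inverse_val_ge:
  assumes M: "M \<in> max_ideals A" and I: "nonzero_ideal I" and g: "g \<in> frac_inverse A I"
  shows "g \<in> val_ge M (- int (ideal_val M I))"
proof (cases "g = 0")
  case False
  obtain a where a: "a \<in> I" "a \<noteq> 0" "val M a = int (ideal_val M I)"
    by (rule ideal_val_attained[OF M I])
  have "g * a \<in> val_ge M 0" using frac_inverse_mult[OF g a(1)] by (rule val_nonneg[OF M])
  then show ?thesis using a False val_mult[OF M, of g a] by (simp add: val_ge_def)
qed (simp add: val_ge_def)

lemma invertible_idealD:
  assumes "invertible_ideal A I"
  shows "nonzero_ideal I" "1 \<in> ideal_prod (ring_on A) I (frac_inverse A I)"
proof -
  show one: "1 \<in> ideal_prod (ring_on A) I (frac_inverse A I)"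
    using assms unfolding invertible_ideal_def ideal_prod_cring_class_ops[of I _ A] by simp
  have "I \<noteq> {0}"
  proof
    assume "I = {0}"
    then have "ideal_prod (ring_on A) I (frac_inverse A I) \<subseteq> {0}"
      by (intro ideal_prod_subset) auto
    then show False using one by auto
  qed
  then show "nonzero_ideal I" using assms by (simp add: nonzero_ideal_def invertible_ideal_def)
qed

text \<open>The product of \<open>I\<close> with its inverse is an ideal of \<open>A\<close>, so it
  is all of \<open>A\<close> as soon as no maximal ideal contains it.\<close>

lemma invertible_idealI:
  assumes I: "ideal I (ring_on A)" 
    and notin: "\<And>M. M \<in> max_ideals A \<Longrightarrow> \<exists>i\<in>I. \<exists>g\<in>frac_inverse A I. g * i \<notin> M"
  shows "invertible_ideal A I"
proof -
  let ?P = "ideal_prod (ring_on A) I (frac_inverse A I)"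
  have "ideal ?P (ring_on A)"
  proof (rule idealI')
    show "?P \<subseteq> A"
    proof (rule ideal_prod_subset)
      show "i * j \<in> A" if "i \<in> I" "j \<in> frac_inverse A I" for i j
        using frac_inverse_mult[OF that(2,1)] by (simp add: mult.commute)
    qed (rule add_in)
    have "0 \<in> frac_inverse A I" by (simp add: frac_inverse_def)
    then show "0 \<in> ?P" using ideal_prod_mult[OF ideal_zero[OF I]] by fastforce
    show "x * y \<in> ?P" if x: "x \<in> A" and y: "y \<in> ?P" for x y
      using y
    proof (induction rule: ideal_prod_induct)
      case (mult i j)
      then show ?case
        using ideal_prod_mult[OF ideal_mult[OF I x mult(1)] mult(2)] by (simp add: mult.assoc)
    qed (simp add: distrib_left ideal_prod_add)
  qed (rule ideal_prod_add)
  then have "?P = A"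
  proof (rule ideal_eq_ringI)
    fix M assume "M \<in> max_ideals A"
    then obtain i g where "i \<in> I" "g \<in> frac_inverse A I" "g * i \<notin> M" using notin by blast
    then show "\<exists>x\<in>?P. x \<notin> M" using ideal_prod_mult[of i I g] by (auto simp: mult.commute)
  qed
  then show ?thesis using I by (simp add: invertible_ideal_def ideal_prod_cring_class_ops[of I _ A])
qed

text \<open>A form of the finite generation of invertible ideals.\<close>

lemma invertible_ideal_finite:
  assumes inv: "invertible_ideal A I"
  obtains F where "finite F" "F \<subseteq> I - {0}"
    "\<And>M. M \<in> max_ideals A \<Longrightarrow> \<exists>h\<in>F. val M h = int (ideal_val M I)"
proof -
  note I = invertible_idealD(1)[OF inv]
  \<comment> \<open>The invariant for the induction over sums of products \<open>i * g\<close>: the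
    finite set \<open>F\<close> bounds, at all \<open>M\<close> at once, the least value of
    \<open>I\<close> relative to the value of \<open>x\<close>. At \<open>x = 1\<close> it says that
    \<open>F\<close> attains the value of \<open>I\<close> everywhere.\<close>
  define Q where "Q x F \<longleftrightarrow> finite F \<and> F \<subseteq> I - {0} \<and>
      (\<forall>M\<in>max_ideals A. x \<noteq> 0 \<longrightarrow> (\<exists>h\<in>F. val M h \<le> val M x + int (ideal_val M I)))" for x F
  have "\<exists>F. Q x F" if "x \<in> ideal_prod (ring_on A) I (frac_inverse A I)" for x
    using that
  proof (induction rule: ideal_prod_induct)
    case (mult i g)
    show ?case
    proof (cases "i * g = 0")
      case True
      then have "Q (i * g) {}" by (simp add: Q_def)
      then show ?thesis ..
    next
      case False
      have "val M i \<le> val M (i * g) + int (ideal_val M I)" if M: "M \<in> max_ideals A" for M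
        using frac_inverse_val_ge[OF M I mult(2)] False val_mult[OF M, of i g]
        by (simp add: val_ge_def)
      then have "Q (i * g) {i}" using mult False by (simp add: Q_def)
      then show ?thesis ..
    qed
  next
    case (add s t)
    then obtain F G where F: "Q s F" and G: "Q t G" by blast
    have "\<exists>h\<in>F \<union> G. val M h \<le> val M (s + t) + int (ideal_val M I)" 
      if M: "M \<in> max_ideals A" and st: "s + t \<noteq> 0" for M
    proof -
      consider "s \<noteq> 0" "val M s \<le> val M (s + t)" | "t \<noteq> 0" "val M t \<le> val M (s + t)"
        using val_add[OF M, of s t] st by (cases "s = 0"; cases "t = 0") (auto simp: min_le_iff_disj)
      then show ?thesis
      proof cases
        case 1
        then obtain h where "h \<in> F" "val M h \<le> val M s + int (ideal_val M I)"
          using F M unfolding Q_def by blast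
        then show ?thesis using 1(2) by (intro bexI[of _ h]) simp_all
      next
        case 2
        then obtain h where "h \<in> G" "val M h \<le> val M t + int (ideal_val M I)"
          using G M unfolding Q_def by blast
        then show ?thesis using 2(2) by (intro bexI[of _ h]) simp_all
      qed
    qed
    then have "Q (s + t) (F \<union> G)" using F G by (simp add: Q_def)
    then show ?case ..
  qed
  from this[OF invertible_idealD(2)[OF inv]] obtain F where "Q 1 F" ..
  then have F: "finite F" "F \<subseteq> I - {0}" 
      "\<And>M. M \<in> max_ideals A \<Longrightarrow> \<exists>h\<in>F. val M h \<le> int (ideal_val M I)"
    by (simp_all add: Q_def val_one)
  have "\<exists>h\<in>F. val M h = int (ideal_val M I)" if M: "M \<in> max_ideals A" for M
  proof -
    obtain h where "h \<in> F" "val M h \<le> int (ideal_val M I)" using F(3)[OF M] by blast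
    moreover from this have "int (ideal_val M I) \<le> val M h"
      using F(2) by (intro ideal_val_le[OF M I]) auto
    ultimately show ?thesis by force
  qed
  with F(1,2) show thesis by (rule that)
qed

subsection \<open>Radical ideals and upper semicontinuity\<close>

text \<open>If the value \<open>n\<close> exceeded 1, then for a uniformizer \<open>p\<close> a
  multiple of \<open>p ^ n\<close> by some \<open>s\<close> outside \<open>M\<close> would be
  divisible by \<open>a\<close> in \<open>A\<close>. Extra factors \<open>s\<close> complete it to
  \<open>(s * p) ^ n\<close> in \<open>I\<close>, so \<open>s * p\<close> is in the radical ideal
  \<open>I\<close> but has value 1.\<close>

lemma ideal_val_radical:
  assumes M: "M \<in> max_ideals A" and I: "nonzero_ideal I" and rad: "radical_ideal A I"
  shows "ideal_val M I \<le> 1"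
proof (rule ccontr)
  define n where "n = ideal_val M I"
  assume "\<not> ideal_val M I \<le> 1"
  then have n: "1 < n" by (simp add: n_def)
  obtain a where a: "a \<in> I" "a \<noteq> 0" "val M a = int n"
    unfolding n_def by (rule ideal_val_attained[OF M I])
  obtain p where p: "p \<in> A" "p \<noteq> 0" "val M p = 1" by (rule uniformizer[OF M])
  have "p ^ n / a \<in> val_ge M 0"
    using a p val_divide[OF M, of "p ^ n" a] val_power[OF M, of p n] by (simp add: val_ge_def)
  then obtain s where s: "s \<in> A" "s \<notin> M" "s * (p ^ n / a) \<in> A"
    by (rule val_denominator[OF M])
  have "s ^ (n - 1) * (s * (p ^ n / a)) * a \<in> I"
    using ideal_mult[OF nonzero_idealD(1)[OF I] mult_in[OF power_in[OF s(1)] s(3)] a(1)] .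
  moreover have "s ^ (n - 1) * (s * (p ^ n / a)) * a = (s * p) ^ n"
    using a(2) n by (simp add: power_mult_distrib power_eq_if[of s n])
  ultimately have "s * p \<in> radical A I"
    using n s(1) p(1) by (auto simp: radical_def intro!: exI[of _ n])
  then have "s * p \<in> I" using rad by (simp add: radical_ideal_def)
  moreover have "s * p \<noteq> 0" "val M (s * p) = 1"
    using p val_eq_0[OF M s(1,2)] val_mult[OF M, of s p] by simp_all
  ultimately have "int n \<le> 1" unfolding n_def using ideal_val_le[OF M I, of "s * p"] by simp
  then show False using n by simp
qed

text \<open>The intersection with \<open>A\<close> makes the empty family yield \<open>A\<close>,
  since \<open>\<Inter>{}\<close> is the whole field.\<close>

lemma radical_ideal_Inter:
  assumes "T \<subseteq> max_ideals A"
  shows "radical_ideal A (A \<inter> \<Inter>T)"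
proof -
  have T: "ideal M (ring_on A)" if "M \<in> T" for M using assms that max_idealsD(1) by blast
  have "ideal (A \<inter> \<Inter>T) (ring_on A)"
    by (rule idealI') (use T ideal_zero ideal_add ideal_mult in \<open>simp_all add: add_in mult_in\<close>)
  moreover have "radical A (A \<inter> \<Inter>T) = A \<inter> \<Inter>T"
  proof
    show "A \<inter> \<Inter>T \<subseteq> radical A (A \<inter> \<Inter>T)"
    proof
      fix x assume "x \<in> A \<inter> \<Inter>T"
      then have "x \<in> A \<and> (0::nat) < 1 \<and> x ^ 1 \<in> A \<inter> \<Inter>T" by simp
      then show "x \<in> radical A (A \<inter> \<Inter>T)" unfolding radical_def by blast
    qed
    show "radical A (A \<inter> \<Inter>T) \<subseteq> A \<inter> \<Inter>T"
    proof
      fix x assume "x \<in> radical A (A \<inter> \<Inter>T)"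
      then obtain n where x: "x \<in> A" and n: "x ^ n \<in> \<Inter>T" unfolding radical_def by blast
      have "x \<in> M" if "M \<in> T" for M
        using max_ideal_power_memD[of M x n] that x n assms by blast
      then show "x \<in> A \<inter> \<Inter>T" using x by blast
    qed
  qed
  ultimately show ?thesis unfolding radical_ideal_def by blast
qed

text \<open>Each radical factor has values 0 or 1. If its value at \<open>M\<close> is 1, that is a
  global maximum; if it is 0, an element of the factor outside \<open>M\<close> gives a
  neighbourhood where the value stays 0. The product of these witnesses handles the whole
  list.\<close>

lemma radical_list_neighbourhood:
  assumes M: "M \<in> max_ideals A"
    and Qs: "\<And>Q. Q \<in> set Qs \<Longrightarrow> nonzero_ideal Q \<and> radical_ideal A Q"
  shows "\<exists>z\<in>A - M. \<forall>N\<in>max_ideals A. z \<notin> N \<longrightarrow>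
    (\<Sum>Q\<leftarrow>Qs. ideal_val N Q) \<le> (\<Sum>Q\<leftarrow>Qs. ideal_val M Q)"
  using Qs
proof (induction Qs)
  case Nil
  then show ?case using max_idealsD(2)[OF M] one_in by auto
next
  case (Cons Q Qs)
  then obtain z where z: "z \<in> A" "z \<notin> M" and
    zN: "\<And>N. N \<in> max_ideals A \<Longrightarrow> z \<notin> N \<Longrightarrow> (\<Sum>Q\<leftarrow>Qs. ideal_val N Q) \<le> (\<Sum>Q\<leftarrow>Qs. ideal_val M Q)"
    by auto
  have Q: "nonzero_ideal Q" "radical_ideal A Q" using Cons.prems[of Q] by auto
  obtain y where y: "y \<in> A" "y \<notin> M" and 
    yN: "\<And>N. N \<in> max_ideals A \<Longrightarrow> y \<notin> N \<Longrightarrow> ideal_val N Q \<le> ideal_val M Q"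
  proof (cases "Q \<subseteq> M")
    case True
    then have "ideal_val N Q \<le> ideal_val M Q" if "N \<in> max_ideals A" for N
      using ideal_val_radical[OF that Q] subset_max_ideal_iff[OF M Q(1)] by simp
    then show thesis using that[of 1] max_idealsD(2)[OF M] by simp
  next
    case False
    then obtain y where y: "y \<in> Q" "y \<notin> M" by blast
    have "ideal_val N Q \<le> ideal_val M Q" if "N \<in> max_ideals A" "y \<notin> N" for N
      using subset_max_ideal_iff[OF that(1) Q(1)] that y(1) by force
    then show thesis using that[of y] y nonzero_idealD(2)[OF Q(1)] by blast
  qed
  have "y * z \<in> A - M" using y z max_idealsD(3)[OF M] by blast
  moreover have "(\<Sum>Q\<leftarrow>Q # Qs. ideal_val N Q) \<le> (\<Sum>Q\<leftarrow>Q # Qs. ideal_val M Q)"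
    if N: "N \<in> max_ideals A" and "y * z \<notin> N" for N
  proof -
    have "y \<notin> N" "z \<notin> N"
      using that ideal_mult[OF max_idealsD(1)[OF N] y(1)] ideal_mult_right[OF max_idealsD(1)[OF N] z(1)]
      by blast+
    then show ?thesis using yN[OF N] zN[OF N] by simp
  qed
  ultimately show ?case by blast
qed

text \<open>If \<open>a \<in> I\<close> has value \<open>e = v\<^sub>M(I)\<close> at \<open>M\<close>, then \<open>h ^ e / a\<close> is integral at \<open>M\<close> for \<open>h \<in> F\<close>, hence
  near \<open>M\<close>, where some \<open>h\<close> has value at most \<open>1\<close>.\<close>

lemma ideal_val_upper_semicontinuous:
  assumes M: "M \<in> max_ideals A" and I: "nonzero_ideal I"
    and F: "finite F" "F \<subseteq> M - {0}" and s: "s \<in> A" "s \<notin> M"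
    and le: "\<And>N. N \<in> max_ideals A \<Longrightarrow> s \<notin> N \<Longrightarrow> \<exists>h\<in>F. val N h \<le> 1"
  shows "\<exists>t\<in>A - M. \<forall>N\<in>max_ideals A. t \<notin> N \<longrightarrow> ideal_val N I \<le> ideal_val M I"
proof -
  define e where "e = ideal_val M I"
  obtain a where a: "a \<in> I" "a \<noteq> 0" "val M a = int e"
    unfolding e_def by (rule ideal_val_attained[OF M I])
  have "\<exists>u. u \<in> A \<and> u \<notin> M \<and> u * (h ^ e / a) \<in> A" if "h \<in> F" for h
  proof -
    have h: "h \<noteq> 0" "h \<in> A" "h \<in> M"
      using that F ideal_subset[OF max_idealsD(1)[OF M]] by auto
    then have "int e * 1 \<le> int e * val M h"
      using mem_max_ideal_iff[OF M] by (intro mult_left_mono) (auto simp: val_ge_def)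
    then have "h ^ e / a \<in> val_ge M 0"
      using a h val_divide[OF M, of "h ^ e" a] val_power[OF M, of h e] by (simp add: val_ge_def)
    then show ?thesis using val_denominator[OF M] by blast
  qed
  then obtain u where u: "\<And>h. h \<in> F \<Longrightarrow> u h \<in> A - M" "\<And>h. h \<in> F \<Longrightarrow> u h * (h ^ e / a) \<in> A"
    by (metis DiffI)
  have uA: "prod u F \<in> A - M" using max_ideal_prod_notin[OF M] u(1) by blast
  then have "s * prod u F \<in> A - M" using s max_idealsD(3)[OF M] by blast
  moreover have "ideal_val N I \<le> e" if N: "N \<in> max_ideals A" and notin: "s * prod u F \<notin> N" for N
  proof -
    note idN = max_idealsD(1)[OF N]
    have "s \<notin> N" using notin uA ideal_mult_right[OF idN, of "prod u F" s] by blast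
    then obtain h where h: "h \<in> F" "val N h \<le> 1" using le[OF N] by blast
    have "h \<noteq> 0" using h F by auto
    have "prod u F \<notin> N" using notin s ideal_mult[OF idN] by blast
    then have "u h \<notin> N" using prod_in_ideal[OF idN F(1) h(1), of u] u(1) by blast
    then have uh: "u h \<noteq> 0" "val N (u h) = 0" using val_eq_0[OF N] u(1)[OF h(1)] by auto
    have "0 \<le> val N (u h * (h ^ e / a))"
      using val_nonneg[OF N u(2)[OF h(1)]] uh \<open>h \<noteq> 0\<close> a by (simp add: val_ge_def)
    also have "val N (u h * (h ^ e / a)) = int e * val N h - val N a"
      using uh \<open>h \<noteq> 0\<close> a val_mult[OF N, of "u h" "h ^ e / a"] val_divide[OF N, of "h ^ e" a] 
        val_power[OF N, of h e] by simp
    also have "int e * val N h \<le> int e * 1" using h(2) by (intro mult_left_mono) simp_all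
    finally show ?thesis using ideal_val_le[OF N I a(1,2)] by simp
  qed
  ultimately show ?thesis unfolding e_def by blast
qed

section \<open>From semicontinuous values to radical factorizations\<close>

lemma SP_domain_if_upper_semicontinuous:
  assumes usc: "\<And>I M. nonzero_ideal I \<Longrightarrow> M \<in> max_ideals A \<Longrightarrow>
    \<exists>t\<in>A - M. \<forall>N\<in>max_ideals A. t \<notin> N \<longrightarrow> ideal_val N I \<le> ideal_val M I"
  shows "SP_domain A"
  unfolding SP_domain_def
proof (intro conjI allI impI)
  show "domain_with_quotient_field A" by (rule quotients)
  fix I assume "ideal I (ring_on A)"
  show "\<exists>Qs. (\<forall>Q\<in>set Qs. radical_ideal A Q) \<and> I = ideal_list_prod A Qs"
  proof (cases "I = {0}")
    case True
    have "radical_ideal A {0}"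
    proof -
      have "ideal {0} (ring_on A)" by (rule idealI') auto
      moreover have "x \<in> radical A {0} \<longleftrightarrow> x = 0" for x 
        by (auto simp: radical_def intro: exI[of _ "1::nat"])
      ultimately show ?thesis by (auto simp: radical_ideal_def)
    qed
    moreover have "ideal_list_prod A [{0}] = {0}"
    proof
      show "ideal_list_prod A [{0}] \<subseteq> {0}"
        unfolding ideal_list_prod_simps by (rule ideal_prod_subset) auto
      show "{0} \<subseteq> ideal_list_prod A [{0}]"
        unfolding ideal_list_prod_simps using ideal_prod_mult[of 0 "{0}" 1 A] by simp
    qed
    ultimately show ?thesis using True by (intro exI[of _ "[{0}]"]) simp
  next
    case False
    then have I: "nonzero_ideal I" using \<open>ideal I (ring_on A)\<close> by (simp add: nonzero_ideal_def)
    \<comment> \<open>\<open>B\<close> collects the \<open>s\<close> such that the values of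
      \<open>I\<close> are bounded on the maximal ideals omitting \<open>s\<close>. Semicontinuity
      makes these open sets cover the spectrum, so \<open>1 \<in> B\<close> and the values have a
      global bound \<open>e\<close>.\<close>
    define B where "B = {s \<in> A. \<exists>e. \<forall>N\<in>max_ideals A. s \<notin> N \<longrightarrow> ideal_val N I \<le> e}"
    have "ideal B (ring_on A)"
    proof (rule idealI')
      show "B \<subseteq> A" by (auto simp: B_def)
      show "0 \<in> B" using ideal_zero max_idealsD(1) by (auto simp: B_def)
      fix x y assume y: "y \<in> B"
      then obtain e where e: "\<And>N. N \<in> max_ideals A \<Longrightarrow> y \<notin> N \<Longrightarrow> ideal_val N I \<le> e" and "y \<in> A"
        unfolding B_def by blast
      show "x * y \<in> B" if x: "x \<in> A"
      proof -
        have "ideal_val N I \<le> e" if N: "N \<in> max_ideals A" "x * y \<notin> N" for N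
          using e[OF N(1)] N(2) ideal_mult[OF max_idealsD(1)[OF N(1)] x] by blast
        then show ?thesis using x \<open>y \<in> A\<close> by (auto simp: B_def)
      qed
      show "x + y \<in> B" if x: "x \<in> B"
      proof -
        obtain d where d: "\<And>N. N \<in> max_ideals A \<Longrightarrow> x \<notin> N \<Longrightarrow> ideal_val N I \<le> d" and "x \<in> A"
          using x unfolding B_def by blast
        have "ideal_val N I \<le> max d e" if "N \<in> max_ideals A" "x + y \<notin> N" for N
          using d[OF that(1)] e[OF that(1)] ideal_add[OF max_idealsD(1)[OF that(1)]] that(2) 
          by (metis max.coboundedI1 max.coboundedI2)
        then show ?thesis using \<open>x \<in> A\<close> \<open>y \<in> A\<close> by (auto simp: B_def)
      qed
    qed
    moreover have "\<exists>x\<in>B. x \<notin> M" if "M \<in> max_ideals A" for M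
      using usc[OF I that] by (auto simp: B_def)
    ultimately have "B = A" by (rule ideal_eq_ringI)
    then have "1 \<in> B" by simp
    then obtain e where e: "\<And>N. N \<in> max_ideals A \<Longrightarrow> ideal_val N I \<le> e"
      using max_idealsD(2) by (auto simp: B_def)
    define Q where "Q n = A \<inter> \<Inter>(V_set A n I)" for n
    have V: "V_set A n I = {M \<in> max_ideals A. n \<le> ideal_val M I}" for n
      by (rule V_set_eq[OF I])
    have rad: "radical_ideal A (Q n)" for n
      unfolding Q_def by (rule radical_ideal_Inter) (auto simp: V)
    obtain a where a: "a \<in> I" "a \<noteq> 0" using nonzero_idealD(3)[OF I] by blast
    have "a \<in> Q n" if "1 \<le> n" for n
      using that a nonzero_idealD(2)[OF I] subset_max_ideal_iff[OF _ I] by (force simp: Q_def V)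
    then have Q: "nonzero_ideal (Q n)" if "1 \<le> n" for n
      using nonzero_idealI[of "Q n" a] rad[of n] that a by (simp add: radical_ideal_def)
    have val_Q: "ideal_val M (Q n) = (if n \<le> ideal_val M I then 1 else 0)"
      if M: "M \<in> max_ideals A" and n: "1 \<le> n" for M n
    proof (cases "n \<le> ideal_val M I")
      case True
      then have "Q n \<subseteq> M" using M by (auto simp: Q_def V)
      then show ?thesis
        using True subset_max_ideal_iff[OF M Q[OF n]] ideal_val_radical[OF M Q[OF n] rad] by simp
    next
      case False
      \<comment> \<open>Semicontinuity shows that \<open>V_set A n I\<close> is closed:
        \<open>t\<close> lies outside \<open>M\<close>, but in every \<open>N\<close> where
        \<open>I\<close> has value at least \<open>n\<close>, because that value exceeds the one at
        \<open>M\<close>.\<close>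
      obtain t where t: "t \<in> A" "t \<notin> M" 
          "\<And>N. N \<in> max_ideals A \<Longrightarrow> t \<notin> N \<Longrightarrow> ideal_val N I \<le> ideal_val M I"
        using usc[OF I M] by blast
      then have "t \<in> Q n" using False by (force simp: Q_def V)
      then show ?thesis using False t subset_max_ideal_iff[OF M Q[OF n]] by auto
    qed
    \<comment> \<open>The value of \<open>I\<close> at \<open>M\<close> is the number of
      \<open>n\<close> from 1 to \<open>ideal_val M I\<close>, and exactly these \<open>Q n\<close>
      contribute 1. For \<open>e = 0\<close> the list is empty and its product is
      \<open>A\<close>.\<close>
    have "I = ideal_list_prod A (map Q [1..<Suc e])"
    proof (rule ideal_eqI[OF I])
      show "nonzero_ideal (ideal_list_prod A (map Q [1..<Suc e]))"
        by (rule nonzero_ideal_list_prod) (use Q in auto)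
      fix M assume M: "M \<in> max_ideals A"
      have "ideal_val M (ideal_list_prod A (map Q [1..<Suc e])) = 
          (\<Sum>n\<leftarrow>[1..<Suc e]. ideal_val M (Q n))"
        by (subst ideal_val_list_prod[OF M]) (use Q in \<open>auto simp: comp_def\<close>)
      also have "\<dots> = (\<Sum>n\<in>{1..<Suc e}. ideal_val M (Q n))"
        by (simp only: interv_sum_list_conv_sum_set_nat set_upt)
      also have "\<dots> = (\<Sum>n\<in>{1..<Suc e}. if n \<in> {1..ideal_val M I} then 1 else 0)"
        using val_Q[OF M] by (intro sum.cong) auto
      also have "\<dots> = card ({1..<Suc e} \<inter> {1..ideal_val M I})"
        by (subst sum.inter_restrict[symmetric]) simp_all
      also have "{1..<Suc e} \<inter> {1..ideal_val M I} = {1..ideal_val M I}" using e[OF M] by auto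
      finally show "ideal_val M I = ideal_val M (ideal_list_prod A (map Q [1..<Suc e]))" by simp
    qed
    then show ?thesis using rad by (intro exI[of _ "map Q [1..<Suc e]"]) auto
  qed
qed

section \<open>Clean ideals with finite \<open>V_set A 2 H\<close> give semicontinuity\<close>

lemma SP_domain_if_clean_ideals:
  assumes clean: "\<And>M. M \<in> noninvertible_max_ideals A \<Longrightarrow>
    \<exists>H. clean_ideal A H \<and> H \<subseteq> M \<and> finite (V_set A 2 H)"
  shows "SP_domain A"
proof (rule SP_domain_if_upper_semicontinuous)
  fix I M assume I: "nonzero_ideal I" and M: "M \<in> max_ideals A"
  show "\<exists>t\<in>A - M. \<forall>N\<in>max_ideals A. t \<notin> N \<longrightarrow> ideal_val N I \<le> ideal_val M I"
  proof (cases "M \<in> noninvertible_max_ideals A")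
    case True
    from clean[OF this] obtain H where cl: "clean_ideal A H" and
        H: "H \<subseteq> M" "finite (V_set A 2 H)" by blast
    from cl have inv: "invertible_ideal A H" by (simp add: clean_ideal_def)
    from cl obtain M' where M': "V_set A 1 H \<inter> noninvertible_max_ideals A = {M'}"
        "\<not> H \<subseteq> ideal_power A M' 2" unfolding clean_ideal_def by blast
    note nzH = invertible_idealD(1)[OF inv]
    have "M \<in> V_set A 1 H" using H(1) M subset_max_ideal_iff[OF M nzH] by (simp add: V_set_eq[OF nzH])
    then have "M = M'" using True M'(1) by blast
    then have "M \<notin> V_set A 2 H" using M'(2) by (simp add: V_set_def)
    have V: "N \<in> max_ideals A \<and> (\<exists>x\<in>N. x \<notin> M)" if "N \<in> V_set A 2 H" for N
      using that \<open>M \<notin> V_set A 2 H\<close> max_ideals_eq[of N M] M by (auto simp: V_set_def)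
    \<comment> \<open>The product of the \<open>x N\<close> lies in every member of the finite set
      \<open>V_set A 2 H\<close> but not in \<open>M\<close>. Where it is omitted, \<open>H\<close>
      has value at most 1, as the semicontinuity lemma requires.\<close>
    then obtain x where x: "\<And>N. N \<in> V_set A 2 H \<Longrightarrow> x N \<in> N - M" by (metis DiffI)
    have xA: "x N \<in> A" if "N \<in> V_set A 2 H" for N
      using x[OF that] V[OF that] ideal_subset[OF max_idealsD(1)] by blast
    have "prod x (V_set A 2 H) \<in> A - M"
      by (rule max_ideal_prod_notin[OF M]) (use x xA in blast)
    then have s: "prod x (V_set A 2 H) \<in> A" "prod x (V_set A 2 H) \<notin> M" by auto
    obtain F where F: "finite F" "F \<subseteq> H - {0}" 
        "\<And>N. N \<in> max_ideals A \<Longrightarrow> \<exists>h\<in>F. val N h = int (ideal_val N H)"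
      using invertible_ideal_finite[OF inv] by blast
    show ?thesis
    proof (rule ideal_val_upper_semicontinuous[OF M I F(1) _ s])
      show "F \<subseteq> M - {0}" using F(2) H(1) by blast
      fix N assume N: "N \<in> max_ideals A" "prod x (V_set A 2 H) \<notin> N"
      have "N \<notin> V_set A 2 H"
        using N prod_in_ideal[OF max_idealsD(1)[OF N(1)] H(2), of N x] x xA by blast
      then have "ideal_val N H \<le> 1" using N(1) by (simp add: V_set_eq[OF nzH])
      moreover obtain h where "h \<in> F" "val N h = int (ideal_val N H)" using F(3)[OF N(1)] by blast
      ultimately show "\<exists>h\<in>F. val N h \<le> 1" by (intro bexI[of _ h]) simp_all
    qed
  next
    case False
    \<comment> \<open>An invertible \<open>M\<close> plays the role of \<open>H\<close> itself: its
      values are at most 1 everywhere, so \<open>s = 1\<close> suffices.\<close>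
    then have inv: "invertible_ideal A M" using M by (simp add: noninvertible_max_ideals_def)
    obtain F where F: "finite F" "F \<subseteq> M - {0}" 
        "\<And>N. N \<in> max_ideals A \<Longrightarrow> \<exists>h\<in>F. val N h = int (ideal_val N M)"
      using invertible_ideal_finite[OF inv] by blast
    show ?thesis
    proof (rule ideal_val_upper_semicontinuous[OF M I F(1,2) one_in max_idealsD(2)[OF M]])
      fix N assume N: "N \<in> max_ideals A"
      then obtain h where "h \<in> F" "val N h = int (ideal_val N M)" using F(3) by blast
      then show "\<exists>h\<in>F. val N h \<le> 1" using ideal_val_max[OF M N] by (intro bexI[of _ h]) simp_all
    qed
  qed
qed

subsection \<open>Isolated maximal ideals and ISP-domains\<close>

lemma frac_inverse_max_ideal_val_ge:
  assumes "M \<in> max_ideals A" "N \<in> max_ideals A" "N \<noteq> M" "g \<in> frac_inverse A M"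
  shows "g \<in> val_ge N 0"
  using frac_inverse_val_ge[OF assms(2) nonzero_ideal_max[OF assms(1)] assms(4)]
    ideal_val_max[OF assms(1,2)] assms(3) by simp

lemma one_frac_inverse: "I \<subseteq> A \<Longrightarrow> 1 \<in> frac_inverse A I"
  by (auto simp: frac_inverse_def)

text \<open>An element \<open>g\<close> of the inverse outside \<open>A\<close> can have negative
  value only at \<open>M\<close>. Multiplying it by a uniformizer in \<open>M\<close> gives an
  element of \<open>A\<close> outside \<open>M\<close>, and this makes \<open>M\<close> invertible.
  Thus a noninvertible \<open>M\<close> has divisorial closure \<open>A\<close>.\<close>

lemma frac_inverse_noninvertible:
  assumes "M \<in> noninvertible_max_ideals A"
  shows "frac_inverse A M \<subseteq> A"
proof (rule ccontr)
  assume "\<not> frac_inverse A M \<subseteq> A"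
  then obtain g where g: "g \<in> frac_inverse A M" "g \<notin> A" by blast
  have M: "M \<in> max_ideals A" and noninv: "\<not> invertible_ideal A M"
    using assms by (simp_all add: noninvertible_max_ideals_def)
  have "g \<notin> val_ge M 0"
    using g mem_ringI[of g] frac_inverse_max_ideal_val_ge[OF M] by blast
  then have "g \<noteq> 0" "val M g < 0" by (simp_all add: val_ge_def)
  obtain p where p: "p \<in> A" "p \<noteq> 0" "val M p = 1" by (rule uniformizer[OF M])
  have "p \<in> M" using p mem_max_ideal_iff[OF M] by (simp add: val_ge_def)
  have "g * p \<in> A" using frac_inverse_mult[OF g(1) \<open>p \<in> M\<close>] .
  moreover have "g * p \<notin> val_ge M 1"
    using p \<open>g \<noteq> 0\<close> \<open>val M g < 0\<close> val_mult[OF M, of g p] by (simp add: val_ge_def)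
  ultimately have gp: "g * p \<notin> M" using mem_max_ideal_iff[OF M] by blast
  have "invertible_ideal A M"
  proof (rule invertible_idealI[OF max_idealsD(1)[OF M]])
    fix N assume N: "N \<in> max_ideals A"
    show "\<exists>i\<in>M. \<exists>g\<in>frac_inverse A M. g * i \<notin> N"
    proof (cases "N = M")
      case True
      then show ?thesis using gp g(1) \<open>p \<in> M\<close> by blast
    next
      case False
      then obtain x where "x \<in> M" "x \<notin> N" using max_ideals_eq[OF M N] by blast
      moreover have "1 \<in> frac_inverse A M"
        by (rule one_frac_inverse[OF ideal_subset[OF max_idealsD(1)[OF M]]])
      ultimately show ?thesis by (metis mult_1)
    qed
  qed
  then show False using noninv by blast
qed

text \<open>The inverse of \<open>M\<close> contains some \<open>g\<close> of value -1 at
  \<open>M\<close> and nonnegative value elsewhere, so \<open>a * g ^ e\<close> with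
  \<open>e = val M a\<close> strips \<open>a\<close> of its \<open>M\<close>-part. Every other
  maximal ideal containing \<open>a\<close> contains \<open>s\<close>, so \<open>M\<close> is
  isolated among the maximal ideals containing \<open>a\<close>.\<close>

lemma invertible_max_isolated:
  assumes M: "M \<in> max_ideals A" and inv: "invertible_ideal A M" and a: "a \<in> A" "a \<noteq> 0"
  shows "\<exists>s\<in>A - M. \<forall>N\<in>max_ideals A. N \<noteq> M \<longrightarrow> val N a \<le> val N s"
proof -
  have "\<not> frac_inverse A M \<subseteq> val_ge M 0"
  proof
    assume *: "frac_inverse A M \<subseteq> val_ge M 0"
    have "ideal_prod (ring_on A) M (frac_inverse A M) \<subseteq> val_ge M 1"
    proof (rule ideal_prod_subset)
      show "i * j \<in> val_ge M 1" if ij: "i \<in> M" "j \<in> frac_inverse A M" for i j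
      proof -
        have "i \<in> val_ge M 1"
          using ij(1) mem_max_ideal_iff[OF M] ideal_subset[OF max_idealsD(1)[OF M]] by blast
        then show ?thesis using val_ge_mult[OF M, of i 1 j 0] ij(2) * by auto
      qed
    qed (rule val_ge_add[OF M])
    then have "1 \<in> val_ge M 1" using invertible_idealD(2)[OF inv] by blast
    then show False using val_one[OF M] by (simp add: val_ge_def)
  qed
  then obtain g where g: "g \<in> frac_inverse A M" "g \<notin> val_ge M 0" by blast
  then have g0: "g \<noteq> 0" by (auto simp: val_ge_def)
  have "val M g = - 1"
    using frac_inverse_val_ge[OF M nonzero_ideal_max[OF M] g(1)] g(2) ideal_val_max[OF M M]
    by (simp add: val_ge_def)
  define e where "e = nat (val M a)"
  define s where "s = a * g ^ e"
  have s0: "s \<noteq> 0" using a g0 by (simp add: s_def)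
  have val_s: "val N s = val N a + int e * val N g" if "N \<in> max_ideals A" for N
    using that a g0 by (simp add: s_def val_mult val_power)
  have "0 \<le> val M a" using val_nonneg[OF M a(1)] a(2) by (simp add: val_ge_def)
  then have sM: "val M s = 0" using val_s[OF M] \<open>val M g = - 1\<close> by (simp add: e_def)
  have le: "val N a \<le> val N s" if N: "N \<in> max_ideals A" "N \<noteq> M" for N
    using val_s[OF N(1)] frac_inverse_max_ideal_val_ge[OF M N g(1)] g0 by (simp add: val_ge_def)
  have "s \<in> A"
  proof (rule mem_ringI)
    fix N assume N: "N \<in> max_ideals A"
    show "s \<in> val_ge N 0"
      using sM le[OF N] val_nonneg[OF N a(1)] a(2) by (cases "N = M") (auto simp: val_ge_def)
  qed
  moreover have "s \<notin> M" using mem_max_ideal_iff[OF M \<open>s \<in> A\<close>] sM s0 by (simp add: val_ge_def)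
  ultimately show ?thesis using le by blast
qed

text \<open>Topologically: \<open>M\<close> is the only accumulation point of the closed set of maximal ideals
  containing \<open>H\<close>.\<close>

lemma finite_outside_neighbourhood:
  assumes H: "nonzero_ideal H" and Z: "V_set A 1 H \<inter> noninvertible_max_ideals A = {M}"
    and x: "x \<in> A" "x \<notin> M"
  shows "finite {N \<in> max_ideals A. H \<subseteq> N \<and> x \<in> N}"
proof -
  \<comment> \<open>Compactness again: the \<open>s\<close> with finite \<open>W s\<close> form an
    ideal, and \<open>W 1\<close> is the set in question.\<close>
  define W where "W s = {N \<in> max_ideals A. H \<subseteq> N \<and> x \<in> N \<and> s \<notin> N}" for s
  have "ideal {s \<in> A. finite (W s)} (ring_on A)"
  proof (rule idealI')
    have "W 0 = {}" using ideal_zero max_idealsD(1) by (auto simp: W_def)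
    then show "0 \<in> {s \<in> A. finite (W s)}" by simp
    have "W (s + t) \<subseteq> W s \<union> W t" for s t
      using ideal_add[OF max_idealsD(1)] unfolding W_def by blast
    then show "s + t \<in> {s \<in> A. finite (W s)}" 
      if "s \<in> {s \<in> A. finite (W s)}" "t \<in> {s \<in> A. finite (W s)}" for s t
      using that finite_subset[of "W (s + t)" "W s \<union> W t"] by auto
    have "W (s * t) \<subseteq> W t" if "s \<in> A" for s t
      using ideal_mult[OF max_idealsD(1) that] unfolding W_def by blast
    then show "s * t \<in> {s \<in> A. finite (W s)}" if "s \<in> A" "t \<in> {s \<in> A. finite (W s)}" for s t
      using that finite_subset[of "W (s * t)" "W t"] by auto
  qed auto
  then have "{s \<in> A. finite (W s)} = A"
  proof (rule ideal_eq_ringI)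
    fix N assume N: "N \<in> max_ideals A"
    have "\<exists>s\<in>A - N. finite (W s)"
    proof (cases "H \<subseteq> N \<and> x \<in> N")
      \<comment> \<open>Here \<open>N\<close> contains \<open>x\<close>, so it differs from
        \<open>M\<close> and must be invertible. The element \<open>s\<close> that isolates
        \<open>N\<close> lies in all other maximal ideals over \<open>H\<close>, leaving at most
        \<open>N\<close> in \<open>W s\<close>.\<close>
      case True
      then have "N \<in> V_set A 1 H" using N subset_max_ideal_iff[OF N H] by (simp add: V_set_eq[OF H])
      then have "N \<notin> noninvertible_max_ideals A" using Z True x by blast
      then have inv: "invertible_ideal A N" using N by (simp add: noninvertible_max_ideals_def)
      obtain a where a: "a \<in> H" "a \<noteq> 0" "a \<in> A" using nonzero_idealD(2,3)[OF H] by blast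
      obtain s where s: "s \<in> A - N" "\<And>P. P \<in> max_ideals A \<Longrightarrow> P \<noteq> N \<Longrightarrow> val P a \<le> val P s"
        using invertible_max_isolated[OF N inv a(3,2)] by blast
      have "s \<in> P" if P: "P \<in> max_ideals A" "H \<subseteq> P" "P \<noteq> N" for P
      proof -
        have "a \<in> val_ge P 1" using P(2) a mem_max_ideal_iff[OF P(1) a(3)] by blast
        then have "s \<in> val_ge P 1" using s(2)[OF P(1,3)] a(2) by (simp add: val_ge_def)
        then show ?thesis using mem_max_ideal_iff[OF P(1)] s(1) by blast
      qed
      then have "W s \<subseteq> {N}" by (auto simp: W_def)
      then show ?thesis using s(1) finite_subset by blast
    next
      case False
      then obtain s where "s \<in> H \<or> s = x" "s \<notin> N" by blast
      then have "s \<in> A - N" "W s = {}" using x nonzero_idealD(2)[OF H] by (auto simp: W_def)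
      then show ?thesis by (metis finite.emptyI)
    qed
    then show "\<exists>s\<in>{s \<in> A. finite (W s)}. s \<notin> N" by blast
  qed
  then have "1 \<in> {s \<in> A. finite (W s)}" by simp
  moreover have "W 1 = {N \<in> max_ideals A. H \<subseteq> N \<and> x \<in> N}"
    using max_idealsD(2) by (auto simp: W_def)
  ultimately show ?thesis by simp
qed

text \<open>For \<open>a\<close> in \<open>H\<close> of least value at \<open>M\<close>, all
  \<open>h / a\<close> with \<open>h \<in> F\<close> are integral at \<open>M\<close>, and as
  \<open>F\<close> is finite, also near \<open>M\<close>. There the value of \<open>H\<close> is at
  most that of \<open>a\<close>, hence at most that of the \<open>h\<close> realizing the value of
  \<open>J\<close>.\<close>

lemma invertible_ideal_val_neighbourhood:
  assumes M: "M \<in> max_ideals A" and J: "invertible_ideal A J" and H: "nonzero_ideal H"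
    and le: "ideal_val M H \<le> ideal_val M J"
  shows "\<exists>z\<in>A - M. \<forall>N\<in>max_ideals A. z \<notin> N \<longrightarrow> ideal_val N H \<le> ideal_val N J"
proof -
  note nzJ = invertible_idealD(1)[OF J]
  obtain a where a: "a \<in> H" "a \<noteq> 0" "val M a = int (ideal_val M H)"
    by (rule ideal_val_attained[OF M H])
  obtain F where F: "finite F" "F \<subseteq> J - {0}" 
      and val_F: "\<And>N. N \<in> max_ideals A \<Longrightarrow> \<exists>h\<in>F. val N h = int (ideal_val N J)"
    using invertible_ideal_finite[OF J] by blast
  have "\<exists>u. u \<in> A - M \<and> u * (h / a) \<in> A" if "h \<in> F" for h
  proof -
    have h: "h \<in> J" "h \<noteq> 0" using that F by auto
    then have "h / a \<in> val_ge M 0"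
      using ideal_val_le[OF M nzJ h] le a val_divide[OF M h(2) a(2)] by (simp add: val_ge_def)
    then show ?thesis using val_denominator[OF M] by blast
  qed
  then obtain u where u: "\<And>h. h \<in> F \<Longrightarrow> u h \<in> A - M" "\<And>h. h \<in> F \<Longrightarrow> u h * (h / a) \<in> A" by metis
  have "prod u F \<in> A - M" by (rule max_ideal_prod_notin[OF M u(1)])
  moreover have "ideal_val N H \<le> ideal_val N J" if N: "N \<in> max_ideals A" and "prod u F \<notin> N" for N
  proof -
    obtain h where h: "h \<in> F" "val N h = int (ideal_val N J)" using val_F[OF N] by blast
    have "h \<noteq> 0" using h F by auto
    have "u h \<notin> N" using prod_in_ideal[OF max_idealsD(1)[OF N] F(1) h(1), of u] u(1) that by blast
    then have uh: "u h \<noteq> 0" "val N (u h) = 0" using val_eq_0[OF N] u(1)[OF h(1)] by auto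
    have "0 \<le> val N (u h * (h / a))"
      using val_nonneg[OF N u(2)[OF h(1)]] uh \<open>h \<noteq> 0\<close> a by (simp add: val_ge_def)
    also have "val N (u h * (h / a)) = val N h - val N a"
      using uh \<open>h \<noteq> 0\<close> a val_mult[OF N, of "u h" "h / a"] val_divide[OF N, of h a] by simp
    finally show ?thesis using ideal_val_le[OF N H a(1,2)] h(2) by simp
  qed
  ultimately show ?thesis by blast
qed

section \<open>ISP-factorization forces \<open>V_set A 2 H\<close> to be finite\<close>

lemma finite_V_set_if_ISP_domain:
  assumes ISP: "ISP_domain A" and clean: "clean_ideal A H"
  shows "finite (V_set A 2 H)"
proof (rule ccontr)
  assume inf: "infinite (V_set A 2 H)"
  have H: "nonzero_ideal H" using clean invertible_idealD(1) by (simp add: clean_ideal_def)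
  obtain M where Z: "V_set A 1 H \<inter> noninvertible_max_ideals A = {M}" 
      and M2: "\<not> H \<subseteq> ideal_power A M 2"
    using clean unfolding clean_ideal_def by blast
  have M: "M \<in> max_ideals A" using Z by (auto simp: V_set_def)
  have "M \<in> V_set A 1 H" using Z by blast
  then have val_MH: "ideal_val M H = 1"
    using M2 subset_max_power_iff[OF M H, of 2] by (simp add: V_set_eq[OF H])
  have V2: "N \<in> max_ideals A" "2 \<le> ideal_val N H" "N \<noteq> M" "H \<subseteq> N" if "N \<in> V_set A 2 H" for N
    using that val_MH subset_max_ideal_iff[OF _ H, of N] by (auto simp: V_set_eq[OF H])
  have inv: "invertible_ideal A N" if "N \<in> V_set A 2 H" for N
    using V2[OF that] Z by (auto simp: V_set_eq[OF H] noninvertible_max_ideals_def)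
  \<comment> \<open>Every infinite part of \<open>V_set A 2 H\<close> meets every basic
    neighbourhood of \<open>M\<close>.\<close>
  have pick: "\<exists>N\<in>T. x \<notin> N" if "infinite T" "T \<subseteq> V_set A 2 H" "x \<in> A" "x \<notin> M" for T x
  proof (rule ccontr)
    assume "\<not> (\<exists>N\<in>T. x \<notin> N)"
    then have "T \<subseteq> {N \<in> max_ideals A. H \<subseteq> N \<and> x \<in> N}" using that(2) V2 by blast
    then show False
      using finite_subset[OF _ finite_outside_neighbourhood[OF H Z that(3,4)]] that(1) by blast
  qed
  obtain S T where S: "S \<subseteq> V_set A 2 H" "infinite S" 
      and T: "T \<subseteq> V_set A 2 H" "infinite T" "S \<inter> T = {}"
    using infinite_split[OF inf] by metis
  \<comment> \<open>\<open>I\<close> has value at least 2 on \<open>S\<close>, yet it contains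
    \<open>H\<close> and so has value at most 1 at \<open>M\<close>.\<close>
  define I where "I = {x \<in> A. \<forall>N\<in>S. x \<in> val_ge N 2}"
  have SM: "N \<in> max_ideals A" if "N \<in> S" for N using V2 S(1) that by blast
  have "ideal I (ring_on A)"
  proof (rule idealI')
    show "x * y \<in> I" if xy: "x \<in> A" "y \<in> I" for x y
    proof -
      have "x * y \<in> val_ge N 2" if "N \<in> S" for N
        using val_ge_mult[OF SM[OF that] val_nonneg[OF SM[OF that] xy(1)], of y 2] xy(2) that
        by (simp add: I_def)
      then show ?thesis using xy by (simp add: I_def mult_in)
    qed
    show "x + y \<in> I" if "x \<in> I" "y \<in> I" for x y
      using that val_ge_add[OF SM] by (auto simp: I_def)
    show "0 \<in> I" by (simp add: I_def val_ge_def)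
  qed (auto simp: I_def)
  have "H \<subseteq> val_ge N 2" if "N \<in> S" for N
    using subset_val_ge_iff[OF SM[OF that] H, of 2] V2(2)[of N] S(1) that by auto
  then have "H \<subseteq> I" using nonzero_idealD(2)[OF H] unfolding I_def by blast
  then have I: "nonzero_ideal I" 
    using nonzero_idealD(3)[OF H] nonzero_idealI[OF \<open>ideal I (ring_on A)\<close>] by blast
  obtain N0 where N0: "N0 \<in> S" using S(2) by fastforce
  have "1 \<notin> val_ge N0 2" using val_one[OF SM[OF N0]] by (simp add: val_ge_def)
  then have "1 \<notin> I" using N0 by (auto simp: I_def)
  then have "I \<noteq> A" using one_in by blast
  then obtain J Qs where J: "invertible_ideal A J" 
    and rad: "\<And>Q. Q \<in> set Qs \<Longrightarrow> radical_ideal A Q"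
    and fact: "I = ideal_prod (ring_on A) J (ideal_list_prod A Qs)"
    using ISP I unfolding ISP_domain_def nonzero_ideal_def by metis
  have nzJ: "nonzero_ideal J" by (rule invertible_idealD(1)[OF J])
  have idQ: "ideal Q (ring_on A)" if "Q \<in> set Qs" for Q
    using rad[OF that] by (simp add: radical_ideal_def)
  have "I \<subseteq> J" "I \<subseteq> ideal_list_prod A Qs"
    using A.ideal_prod_inter[OF nonzero_idealD(1)[OF nzJ] ideal_list_prod_subset(1)[of Qs]] idQ
    unfolding fact by blast+
  have Qs: "nonzero_ideal Q" if "Q \<in> set Qs" for Q
  proof -
    have "I \<subseteq> Q" using \<open>I \<subseteq> ideal_list_prod A Qs\<close> ideal_list_prod_subset(2)[of Qs Q] idQ that by blast
    then show ?thesis using nonzero_idealD(3)[OF I] nonzero_idealI[OF idQ[OF that]] by blast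
  qed
  have val_I: "ideal_val N I = ideal_val N J + (\<Sum>Q\<leftarrow>Qs. ideal_val N Q)" if "N \<in> max_ideals A" for N
    unfolding fact using ideal_val_prod[OF that nzJ nonzero_ideal_list_prod] 
      ideal_val_list_prod[OF that] Qs by simp
  show False
  proof (cases "J \<subseteq> M")
    case True
    then have "ideal_val M H \<le> ideal_val M J" using val_MH subset_max_ideal_iff[OF M nzJ] by simp
    then obtain z where z: "z \<in> A" "z \<notin> M" 
        "\<And>N. N \<in> max_ideals A \<Longrightarrow> z \<notin> N \<Longrightarrow> ideal_val N H \<le> ideal_val N J"
      using invertible_ideal_val_neighbourhood[OF M J H] by blast
    then obtain N where N: "N \<in> V_set A 2 H" "N \<notin> S" "z \<notin> N"
      using pick[OF T(2,1) z(1,2)] T(1,3) by blast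
    note NM = V2(1)[OF N(1)]
    obtain a where a: "a \<in> H" "a \<noteq> 0" "a \<in> A" using nonzero_idealD(2,3)[OF H] by blast
    \<comment> \<open>Stripping \<open>a\<close> of its \<open>N\<close>-part keeps its values on
      \<open>S\<close> at least 2. So \<open>s \<in> I\<close> lies outside \<open>N\<close>, and
      \<open>I\<close> has value 0 where its factor \<open>J\<close> has value at least 2.\<close>
    obtain s where s: "s \<in> A" "s \<notin> N" "\<And>P. P \<in> max_ideals A \<Longrightarrow> P \<noteq> N \<Longrightarrow> val P a \<le> val P s"
      using invertible_max_isolated[OF NM inv[OF N(1)] a(3,2)] by blast
    have "s \<in> val_ge P 2" if P: "P \<in> S" for P
    proof -
      have "P \<noteq> N" using P N(2) by blast
      moreover have "2 \<le> val P a"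
        using ideal_val_le[OF SM[OF P] H a(1,2)] V2(2)[of P] S(1) P by auto
      ultimately show ?thesis using s(3)[OF SM[OF P]] by (simp add: val_ge_def)
    qed
    then have "s \<in> I" using s(1) by (simp add: I_def)
    then have "ideal_val N I = 0" using s(2) subset_max_ideal_iff[OF NM I] by auto
    moreover have "2 \<le> ideal_val N J" using z(3)[OF NM N(3)] V2(2)[OF N(1)] by simp
    ultimately show False using val_I[OF NM] by simp
  next
    case False
    then obtain x where x: "x \<in> J" "x \<notin> M" by blast
    then have xA: "x \<in> A" using nonzero_idealD(2)[OF nzJ] by blast
    \<comment> \<open>Near \<open>M\<close>, the element \<open>x\<close> makes the value of
      \<open>J\<close> vanish and \<open>z\<close> bounds the radical factors by their values at
      \<open>M\<close>. A point of \<open>S\<close> there would have value at most 1.\<close>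
    obtain z where z: "z \<in> A" "z \<notin> M" "\<And>N. N \<in> max_ideals A \<Longrightarrow> z \<notin> N \<Longrightarrow>
        (\<Sum>Q\<leftarrow>Qs. ideal_val N Q) \<le> (\<Sum>Q\<leftarrow>Qs. ideal_val M Q)"
      using radical_list_neighbourhood[OF M, of Qs] Qs rad by blast
    have "x * z \<notin> M" using max_idealsD(3)[OF M] x(2) xA z(1,2) by blast
    then obtain N where N: "N \<in> S" "x * z \<notin> N" using pick[OF S(2,1) mult_in[OF xA z(1)]] by blast
    note NM = SM[OF N(1)]
    have "x \<notin> N" "z \<notin> N"
      using N(2) ideal_mult[OF max_idealsD(1)[OF NM] xA] 
        ideal_mult_right[OF max_idealsD(1)[OF NM] z(1)] by blast+
    have "ideal_val N I = (\<Sum>Q\<leftarrow>Qs. ideal_val N Q)"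
      using val_I[OF NM] subset_max_ideal_iff[OF NM nzJ] x(1) \<open>x \<notin> N\<close> by auto
    also have "\<dots> \<le> ideal_val M I" using z(3)[OF NM \<open>z \<notin> N\<close>] val_I[OF M] by simp
    also have "\<dots> \<le> 1" using ideal_val_antimono[OF M H I \<open>H \<subseteq> I\<close>] val_MH by simp
    finally show False using subset_val_ge_iff[OF NM I, of 2] N(1) by (auto simp: I_def)
  qed
qed

end

section \<open>Clean ideals from weak factorization\<close>

text \<open>A set of \<open>\<U>\<close> separating two points cuts an infinite member into two
  smaller members, one of them infinite. This gives a strictly decreasing sequence \<open>D\<close>;
  points \<open>p n\<close> chosen in \<open>D n - D (Suc n)\<close> are isolated from one another
  by these differences.\<close>

lemma infinite_discrete_subset:
  fixes T :: "'a set" and \<U> :: "'a set set"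
  assumes inf: "infinite T" and T: "T \<in> \<U>"
    and inter: "\<And>U V. U \<in> \<U> \<Longrightarrow> V \<in> \<U> \<Longrightarrow> U \<inter> V \<in> \<U>"
    and compl: "\<And>U. U \<in> \<U> \<Longrightarrow> T - U \<in> \<U>"
    and sep: "\<And>p q. p \<in> T \<Longrightarrow> q \<in> T \<Longrightarrow> p \<noteq> q \<Longrightarrow> \<exists>U\<in>\<U>. p \<in> U \<and> q \<notin> U"
  shows "\<exists>S\<subseteq>T. infinite S \<and> (\<forall>p\<in>S. \<exists>U\<in>\<U>. U \<inter> S = {p})"
proof -
  define P where "P U \<longleftrightarrow> U \<in> \<U> \<and> U \<subseteq> T \<and> infinite U" for U
  have step: "\<exists>V. P V \<and> V \<subset> U" if U: "P U" for U
  proof -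
    obtain p where p: "p \<in> U" using U unfolding P_def by (metis finite.emptyI ex_in_conv)
    have "infinite (U - {p})" using U by (simp add: P_def)
    then obtain q where q: "q \<in> U" "q \<noteq> p" by (metis finite.emptyI ex_in_conv DiffE insertI1)
    obtain V where V: "V \<in> \<U>" "p \<in> V" "q \<notin> V" using sep[of p q] p q U by (auto simp: P_def)
    have "U = (U \<inter> V) \<union> (U \<inter> (T - V))" using U by (auto simp: P_def)
    then have "infinite (U \<inter> V) \<or> infinite (U \<inter> (T - V))" using U by (metis P_def finite_UnI)
    then show ?thesis
    proof
      assume "infinite (U \<inter> V)"
      then have "P (U \<inter> V)" using U V(1) inter by (auto simp: P_def)
      moreover have "U \<inter> V \<subset> U" using q V by blast
      ultimately show ?thesis by blast
    next
      assume "infinite (U \<inter> (T - V))"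
      then have "P (U \<inter> (T - V))" using U inter[OF _ compl[OF V(1)]] by (auto simp: P_def)
      moreover have "U \<inter> (T - V) \<subset> U" using p V by blast
      ultimately show ?thesis by blast
    qed
  qed
  have "P T" using inf T by (simp add: P_def)
  then obtain D where D: "\<And>n. P (D n)" "\<And>n. D (Suc n) \<subset> D n"
    using dependent_nat_choice[of "\<lambda>_. P" "\<lambda>_ U V. V \<subset> U"] step by metis
  have "D (Suc n) \<subseteq> D n" for n using D(2)[of n] by blast
  then have mono: "D n \<subseteq> D m" if "m \<le> n" for m n
    using lift_Suc_antimono_le[of D, OF _ that] by blast
  have "\<exists>p. p \<in> D n - D (Suc n)" for n using D(2)[of n] by blast
  then obtain p where p: "\<And>n. p n \<in> D n" "\<And>n. p n \<notin> D (Suc n)" by (metis DiffE)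
  have p_iff: "p m \<in> D n \<longleftrightarrow> n \<le> m" for m n
    using mono[of n m] mono[of "Suc m" n] p[of m] by (cases "n \<le> m") auto
  have "inj p" by (rule injI) (metis p_iff antisym order_refl)
  then have "infinite (range p)" using finite_imageD by blast
  moreover have "range p \<subseteq> T" using p(1) D(1) by (auto simp: P_def)
  moreover have "\<exists>U\<in>\<U>. U \<inter> range p = {x}" if x: "x \<in> range p" for x
  proof -
    obtain n where n: "x = p n" using x by blast
    have "D n \<inter> (T - D (Suc n)) \<in> \<U>" using inter compl D(1) by (simp add: P_def)
    moreover have "p m \<in> T" for m using D(1) p(1) by (auto simp: P_def)
    then have "D n \<inter> (T - D (Suc n)) \<inter> range p = {p n}"
      using p_iff by (auto simp: not_less_eq_eq)
    ultimately show ?thesis using n by blast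
  qed
  ultimately show ?thesis by blast
qed

context almost_dedekind_domain
begin

text \<open>The closed subset \<open>V(a)\<close> of the maximal spectrum is zero-dimensional: modulo the radical of
  \<open>a\<close>, the ring is von Neumann regular, and \<open>e\<close> is an idempotent generating the same ideal as \<open>x\<close>.\<close>

lemma idempotent_modulo:
  assumes a: "a \<in> A" "a \<noteq> 0" and x: "x \<in> A"
  obtains e where "e \<in> A" 
    "\<And>P. P \<in> max_ideals A \<Longrightarrow> a \<in> P \<Longrightarrow> x \<in> P \<Longrightarrow> e \<in> P"
    "\<And>P. P \<in> max_ideals A \<Longrightarrow> a \<in> P \<Longrightarrow> x \<notin> P \<Longrightarrow> 1 - e \<in> P"
proof -
  \<comment> \<open>Membership of \<open>1\<close> in \<open>K\<close> gives \<open>y\<close> with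
    \<open>x\<close> congruent to \<open>x * x * y\<close> modulo every maximal ideal containing
    \<open>a\<close>; then \<open>e = x * y\<close> is idempotent modulo these ideals.\<close>
  define K where "K = {z \<in> A. \<exists>y\<in>A. \<forall>P\<in>max_ideals A. a \<in> P \<longrightarrow> z * x - x * x * y \<in> P}"
  have KI: "z \<in> K" if "z \<in> A" "y \<in> A" "\<And>P. P \<in> max_ideals A \<Longrightarrow> a \<in> P \<Longrightarrow> z * x - x * x * y \<in> P" for z y
    using that by (auto simp: K_def)
  have "ideal K (ring_on A)"
  proof (rule idealI')
    show "0 \<in> K" by (rule KI[of 0 0]) (use ideal_zero max_idealsD(1) in auto)
    fix z w assume w: "w \<in> K"
    then obtain y where y: "y \<in> A" "w \<in> A" 
        "\<And>P. P \<in> max_ideals A \<Longrightarrow> a \<in> P \<Longrightarrow> w * x - x * x * y \<in> P"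
      unfolding K_def by blast
    show "z * w \<in> K" if z: "z \<in> A"
    proof (rule KI[of _ "z * y"])
      fix P assume P: "P \<in> max_ideals A" "a \<in> P"
      have "z * w * x - x * x * (z * y) = z * (w * x - x * x * y)" by (simp add: algebra_simps)
      then show "z * w * x - x * x * (z * y) \<in> P"
        using ideal_mult[OF max_idealsD(1)[OF P(1)] z y(3)[OF P]] by simp
    qed (use z y in auto)
    show "z + w \<in> K" if z: "z \<in> K"
    proof -
      obtain y' where y': "y' \<in> A" "z \<in> A" 
          "\<And>P. P \<in> max_ideals A \<Longrightarrow> a \<in> P \<Longrightarrow> z * x - x * x * y' \<in> P"
        using z unfolding K_def by blast
      show ?thesis
      proof (rule KI[of _ "y' + y"])
        fix P assume P: "P \<in> max_ideals A" "a \<in> P"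
        have "(z + w) * x - x * x * (y' + y) = (z * x - x * x * y') + (w * x - x * x * y)"
          by (simp add: algebra_simps)
        then show "(z + w) * x - x * x * (y' + y) \<in> P"
          using ideal_add[OF max_idealsD(1)[OF P(1)] y'(3)[OF P] y(3)[OF P]] by simp
      qed (use y y' in auto)
    qed
  qed (auto simp: K_def)
  then have "K = A"
  proof (rule ideal_eq_ringI)
    fix M assume M: "M \<in> max_ideals A"
    consider "x \<notin> M" | "a \<notin> M" | "x = 0" | "x \<in> M" "a \<in> M" "x \<noteq> 0" by blast
    then show "\<exists>z\<in>K. z \<notin> M"
    proof cases
      case 1
      have "x \<in> K" by (rule KI[of x 1]) (use x ideal_zero max_idealsD(1) in auto)
      then show ?thesis using 1 by blast
    next
      case 2
      have "a \<in> K" 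
        by (rule KI[of a 0]) (use a x ideal_mult_right max_idealsD(1) in auto)
      then show ?thesis using 2 by blast
    next
      case 3
      have "1 \<in> K" by (rule KI[of 1 0]) (use 3 ideal_zero max_idealsD(1) in auto)
      then show ?thesis using max_idealsD(2)[OF M] by blast
    next
      case 4
      \<comment> \<open>As \<open>x\<close> has value at least 1 at \<open>M\<close>, the power
        \<open>x ^ m\<close> has at least the value of \<open>a\<close>. So \<open>z * x ^ m\<close>
        is a multiple of \<open>a\<close>, and each \<open>P\<close> containing \<open>a\<close>
        contains \<open>z\<close> or \<open>x\<close>.\<close>
      define m where "m = nat (val M a)"
      have "1 \<le> val M a" "1 \<le> val M x"
        using 4 a x mem_max_ideal_iff[OF M] by (auto simp: val_ge_def)
      then have "val M a \<le> int m * val M x"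
        using mult_left_mono[of 1 "val M x" "int m"] by (simp add: m_def)
      then have "x ^ m / a \<in> val_ge M 0"
        using a 4(3) val_divide[OF M, of "x ^ m" a] val_power[OF M, of x m] by (simp add: val_ge_def)
      then obtain z where z: "z \<in> A" "z \<notin> M" "z * (x ^ m / a) \<in> A" by (rule val_denominator[OF M])
      have "z \<in> K"
      proof (rule KI[of z 0])
        fix P assume P: "P \<in> max_ideals A" "a \<in> P"
        note idP = max_idealsD(1)[OF P(1)]
        have "z * (x ^ m / a) * a \<in> P" by (rule ideal_mult[OF idP z(3) P(2)])
        then have "z * x ^ m \<in> P" using a by simp
        then have "z \<in> P \<or> x \<in> P"
          using max_idealsD(3)[OF P(1) z(1) power_in[OF x]] max_ideal_power_memD[OF P(1) x] by blast
        then show "z * x - x * x * 0 \<in> P" 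
          using ideal_mult[OF idP z(1)] ideal_mult_right[OF idP x] by auto
      qed (use z in auto)
      then show ?thesis using z(2) by blast
    qed
  qed
  then have "1 \<in> K" by simp
  then obtain y where y: "y \<in> A" "\<And>P. P \<in> max_ideals A \<Longrightarrow> a \<in> P \<Longrightarrow> 1 * x - x * x * y \<in> P"
    unfolding K_def by blast
  show thesis
  proof (rule that[of "x * y"])
    show "x * y \<in> A" using x y(1) by auto
    show "x * y \<in> P" if "P \<in> max_ideals A" "x \<in> P" for P
      using ideal_mult_right[OF max_idealsD(1)[OF that(1)] y(1) that(2)] .
    show "1 - x * y \<in> P" if P: "P \<in> max_ideals A" "a \<in> P" "x \<notin> P" for P
    proof -
      have "x * (1 - x * y) \<in> P" using y(2)[OF P(1,2)] by (simp add: algebra_simps)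
      moreover have "1 - x * y \<in> A" using x y(1) by auto
      ultimately show ?thesis using max_idealsD(3)[OF P(1) x] P(3) by blast
    qed
  qed
qed

text \<open>If infinitely many noninvertible maximal ideals contain \<open>a\<close>, some infinite set \<open>S\<close> of them is
  discrete. Locally at \<open>M \<in> S\<close>, the intersection \<open>Q\<close> of \<open>S\<close> equals \<open>M\<close>, whose divisorial closure
  is \<open>A\<close>. So every \<open>M \<in> S\<close> would have to occur among the finitely many maximal factors of \<open>Q\<close>.\<close>

lemma finite_noninvertible_max_ideals:
  assumes wf: "weak_factorization A" and a: "a \<in> A" "a \<noteq> 0"
  shows "finite {M \<in> noninvertible_max_ideals A. a \<in> M}"
proof (rule ccontr)
  define T where "T = {M \<in> noninvertible_max_ideals A. a \<in> M}"
  assume "infinite {M \<in> noninvertible_max_ideals A. a \<in> M}"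
  then have inf: "infinite T" by (simp add: T_def)
  have T: "M \<in> max_ideals A" "a \<in> M" "frac_inverse A M \<subseteq> A" if "M \<in> T" for M
    using that frac_inverse_noninvertible[of M] by (auto simp: T_def noninvertible_max_ideals_def)
  \<comment> \<open>Traces on \<open>T\<close> of basic open sets. They are closed under complement
    because \<open>idempotent_modulo\<close> turns the complement of \<open>U x\<close> into
    \<open>U (1 - e)\<close>.\<close>
  define U where "U x = {M \<in> T. x \<notin> M}" for x
  have "\<exists>S\<subseteq>T. infinite S \<and> (\<forall>M\<in>S. \<exists>V\<in>U ` A. V \<inter> S = {M})"
  proof (rule infinite_discrete_subset[OF inf, of "U ` A"])
    have "T = U 1" using T(1) max_idealsD(2) by (auto simp: U_def)
    then show "T \<in> U ` A" by (metis imageI one_in)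
    show "V \<inter> W \<in> U ` A" if VW: "V \<in> U ` A" "W \<in> U ` A" for V W
    proof -
      obtain x where x: "V = U x" "x \<in> A" using VW(1) by (rule imageE)
      obtain y where y: "W = U y" "y \<in> A" using VW(2) by (rule imageE)
      note xy = x(2) y(2) x(1) y(1)
      have "x * y \<in> M \<longleftrightarrow> x \<in> M \<or> y \<in> M" if "M \<in> T" for M
        using max_idealsD(3)[OF T(1)[OF that] xy(1,2)] ideal_mult[OF max_idealsD(1)[OF T(1)[OF that]] xy(1)]
          ideal_mult_right[OF max_idealsD(1)[OF T(1)[OF that]] xy(2)] by blast
      then have "V \<inter> W = U (x * y)" using xy by (auto simp: U_def)
      then show ?thesis using imageI[OF mult_in[OF xy(1,2)], of U] by simp
    qed
    show "T - V \<in> U ` A" if V: "V \<in> U ` A" for V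
    proof -
      obtain x where x: "V = U x" "x \<in> A" using V by (rule imageE)
      obtain e where e: "e \<in> A" 
        "\<And>P. P \<in> max_ideals A \<Longrightarrow> a \<in> P \<Longrightarrow> x \<in> P \<Longrightarrow> e \<in> P"
        "\<And>P. P \<in> max_ideals A \<Longrightarrow> a \<in> P \<Longrightarrow> x \<notin> P \<Longrightarrow> 1 - e \<in> P"
        using idempotent_modulo[OF a x(2)] by blast
      have "1 - e \<notin> M \<longleftrightarrow> x \<in> M" if "M \<in> T" for M
      proof -
        note M = T(1,2)[OF that]
        have "\<not> (e \<in> M \<and> 1 - e \<in> M)"
          using ideal_add[OF max_idealsD(1)[OF M(1)], of e "1 - e"] max_idealsD(2)[OF M(1)] by auto
        then show ?thesis using e(2,3)[OF M] by blast
      qed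
      then have "T - V = U (1 - e)" using x by (auto simp: U_def)
      then show ?thesis using imageI[OF diff_in[OF one_in e(1)], of U] by simp
    qed
    show "\<exists>V\<in>U ` A. M \<in> V \<and> N \<notin> V" if MN: "M \<in> T" "N \<in> T" "M \<noteq> N" for M N
    proof -
      obtain x where "x \<in> N" "x \<notin> M" using max_ideals_eq[OF T(1)[OF MN(2)] T(1)[OF MN(1)]] MN(3) by blast
      moreover from this have "x \<in> A" using ideal_subset[OF max_idealsD(1)[OF T(1)[OF MN(2)]]] by blast
      ultimately have "U x \<in> U ` A" "M \<in> U x" "N \<notin> U x" using MN by (simp_all add: U_def)
      then show ?thesis by blast
    qed
  qed
  then obtain S where S: "S \<subseteq> T" "infinite S" "\<And>M. M \<in> S \<Longrightarrow> \<exists>V\<in>U ` A. V \<inter> S = {M}"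
    by metis
  have "\<exists>b. b \<in> A \<and> b \<notin> M \<and> (\<forall>N\<in>S. N \<noteq> M \<longrightarrow> b \<in> N)" if M: "M \<in> S" for M
  proof -
    obtain x where "x \<in> A" "U x \<inter> S = {M}" using S(3)[OF M] by auto
    then show ?thesis using S(1) M by (intro exI[of _ x]) (auto simp: U_def)
  qed
  then obtain b where b: "\<And>M. M \<in> S \<Longrightarrow> b M \<in> A" "\<And>M. M \<in> S \<Longrightarrow> b M \<notin> M" 
      "\<And>M N. M \<in> S \<Longrightarrow> N \<in> S \<Longrightarrow> N \<noteq> M \<Longrightarrow> b M \<in> N" by metis
  have Smax: "M \<in> max_ideals A" if "M \<in> S" for M using T S(1) that by blast
  define Q where "Q = A \<inter> \<Inter>S"
  have idQ: "ideal Q (ring_on A)"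
    using radical_ideal_Inter[of S] Smax unfolding Q_def radical_ideal_def by blast
  have "a \<in> Q" using a T(2) S(1) by (auto simp: Q_def)
  then have "Q \<noteq> {0}" using a by blast
  \<comment> \<open>Since \<open>b M\<close> lies in all members of \<open>S\<close> except
    \<open>M\<close>, it multiplies \<open>M\<close> into \<open>Q\<close>. Hence
    \<open>b M * y\<close> carries \<open>M\<close> into \<open>A\<close> for \<open>y\<close> in
    the inverse of \<open>Q\<close>, and the inverse of \<open>M\<close> lies in
    \<open>A\<close>.\<close>
  have bQ: "b M \<in> div_closure A Q" if M: "M \<in> S" for M
  proof -
    have "b M * y \<in> A" if y: "y \<in> frac_inverse A Q" for y
    proof -
      have "b M * y * m \<in> A" if m: "m \<in> M" for m
      proof -
        have mA: "m \<in> A" using m ideal_subset[OF max_idealsD(1)[OF Smax[OF M]]] by blast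
        have "b M * m \<in> N" if N: "N \<in> S" for N
        proof (cases "N = M")
          case True
          then show ?thesis using ideal_mult[OF max_idealsD(1)[OF Smax[OF M]] b(1)[OF M] m] by simp
        next
          case False
          then show ?thesis
            using ideal_mult_right[OF max_idealsD(1)[OF Smax[OF N]] mA b(3)[OF M N]] by blast
        qed
        then have "b M * m \<in> Q" using b(1)[OF M] mA by (auto simp: Q_def)
        from frac_inverse_mult[OF y this] show ?thesis by (simp add: mult_ac)
      qed
      then have "b M * y \<in> frac_inverse A M" by (simp add: frac_inverse_def)
      then show ?thesis using T(3) S(1) M by blast
    qed
    then show ?thesis by (simp add: div_closure_def frac_inverse_def[of A "frac_inverse A Q"])
  qed
  obtain M0 where "M0 \<in> S" using S(2) by fastforce
  then have "b M0 \<notin> Q" using b(2) by (auto simp: Q_def)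
  then have "Q \<noteq> div_closure A Q" using bQ[OF \<open>M0 \<in> S\<close>] by blast
  then obtain Ms where Ms: "set Ms \<subseteq> max_ideals A" 
      and fact: "Q = ideal_prod (ring_on A) (div_closure A Q) (ideal_list_prod A Ms)"
    using wf idQ \<open>Q \<noteq> {0}\<close> unfolding weak_factorization_def by blast
  have "\<not> S \<subseteq> set Ms" using S(2) finite_subset by blast
  then obtain M where M: "M \<in> S" "M \<notin> set Ms" by blast
  have nz: "nonzero_ideal N" if "N \<in> set Ms" for N using that Ms nonzero_ideal_max by blast
  have "ideal_val M N = 0" if "N \<in> set Ms" for N
    using that M(2) Ms ideal_val_max[OF _ Smax[OF M(1)], of N] by auto
  then have "ideal_val M (ideal_list_prod A Ms) = 0"
    using ideal_val_list_prod[OF Smax[OF M(1)] nz] by (simp add: sum_list_0 cong: map_cong)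
  moreover have nzMs: "nonzero_ideal (ideal_list_prod A Ms)" by (rule nonzero_ideal_list_prod[OF nz])
  ultimately have "\<not> ideal_list_prod A Ms \<subseteq> M"
    using subset_max_ideal_iff[OF Smax[OF M(1)] nzMs] by simp
  then obtain c where c: "c \<in> ideal_list_prod A Ms" "c \<notin> M" by blast
  have "c \<in> A" using c(1) nonzero_idealD(2)[OF nzMs] by blast
  have "b M * c \<in> Q" by (subst fact) (rule ideal_prod_mult[OF bQ[OF M(1)] c(1)])
  then have "b M * c \<in> M" using M(1) by (auto simp: Q_def)
  then show False using max_idealsD(3)[OF Smax[OF M(1)] b(1)[OF M(1)] \<open>c \<in> A\<close>] b(2)[OF M(1)] c(2) by blast
qed

text \<open>Locally one of the two generators divides the other.\<close>

lemma invertible_two_generated: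
  assumes a: "a \<in> A" "a \<noteq> 0" and x: "x \<in> A"
  shows "invertible_ideal A {a * r + x * t |r t. r \<in> A \<and> t \<in> A}" (is "invertible_ideal A ?H")
proof (rule invertible_idealI)
  show "ideal ?H (ring_on A)"
  proof (rule idealI')
    show "?H \<subseteq> A" using a x by auto
    have "0 = a * 0 + x * 0 \<and> 0 \<in> A \<and> 0 \<in> A" by simp
    then show "0 \<in> ?H" by blast
    show "u + w \<in> ?H" if uw: "u \<in> ?H" "w \<in> ?H" for u w
    proof -
      obtain r t r' t' where "u = a * r + x * t" "w = a * r' + x * t'" "r \<in> A" "t \<in> A" "r' \<in> A" "t' \<in> A"
        using uw by blast
      then have "u + w = a * (r + r') + x * (t + t') \<and> r + r' \<in> A \<and> t + t' \<in> A"
        by (auto simp: algebra_simps)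
      then show ?thesis by blast
    qed
    show "u * w \<in> ?H" if u: "u \<in> A" and w: "w \<in> ?H" for u w
    proof -
      obtain r t where "w = a * r + x * t" "r \<in> A" "t \<in> A" using w by blast
      then have "u * w = a * (u * r) + x * (u * t) \<and> u * r \<in> A \<and> u * t \<in> A"
        using u by (auto simp: algebra_simps)
      then show ?thesis by blast
    qed
  qed
  have gen: "a \<in> ?H" "x \<in> ?H"
  proof -
    have "a = a * 1 + x * 0 \<and> 1 \<in> A \<and> 0 \<in> A" by simp
    then show "a \<in> ?H" by blast
    have "x = a * 0 + x * 1 \<and> 0 \<in> A \<and> 1 \<in> A" by simp
    then show "x \<in> ?H" by blast
  qed
  fix N assume N: "N \<in> max_ideals A"
  have inv: "g \<in> frac_inverse A ?H" if "g * a \<in> A" "g * x \<in> A" for g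
  proof -
    have "g * (a * r + x * t) \<in> A" if "r \<in> A" "t \<in> A" for r t
      using add_in[OF mult_in[OF \<open>g * a \<in> A\<close> that(1)] mult_in[OF \<open>g * x \<in> A\<close> that(2)]] 
      by (simp add: algebra_simps)
    then show ?thesis by (auto simp: frac_inverse_def)
  qed
  show "\<exists>i\<in>?H. \<exists>g\<in>frac_inverse A ?H. g * i \<notin> N"
  proof (cases "x = 0 \<or> val N a \<le> val N x")
    case True
    then have "x / a \<in> val_ge N 0" using a val_divide[OF N, of x a] by (auto simp: val_ge_def)
    then obtain s where s: "s \<in> A" "s \<notin> N" "s * (x / a) \<in> A" by (rule val_denominator[OF N])
    \<comment> \<open>\<open>s / a\<close> multiplies both generators into \<open>A\<close> and
      sends \<open>a\<close> to \<open>s\<close>, which is outside \<open>N\<close>.\<close>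
    then have "s / a \<in> frac_inverse A ?H" using a by (intro inv) simp_all
    then show ?thesis using gen(1) s(2) a(2) by (intro bexI[of _ a] bexI[of _ "s / a"]) simp_all
  next
    case False
    then have "a / x \<in> val_ge N 0" using a val_divide[OF N, of a x] by (simp add: val_ge_def)
    then obtain s where s: "s \<in> A" "s \<notin> N" "s * (a / x) \<in> A" by (rule val_denominator[OF N])
    then have "s / x \<in> frac_inverse A ?H" using False by (intro inv) simp_all
    then show ?thesis using gen(2) s(2) False by (intro bexI[of _ x] bexI[of _ "s / x"]) simp_all
  qed
qed

text \<open>An element \<open>a\<close> of value 1 at \<open>M\<close> keeps \<open>H\<close> out of
  the square of \<open>M\<close> and lies in only finitely many noninvertible maximal ideals. A
  second generator \<open>x\<close> in \<open>M\<close> avoids the others among these.\<close>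

lemma exists_clean_ideal:
  assumes wf: "weak_factorization A" and MZ: "M \<in> noninvertible_max_ideals A"
  shows "\<exists>H. clean_ideal A H \<and> H \<subseteq> M"
proof -
  have M: "M \<in> max_ideals A" using MZ by (simp add: noninvertible_max_ideals_def)
  note idM = max_idealsD(1)[OF M]
  obtain a where a: "a \<in> A" "a \<noteq> 0" "val M a = 1" by (rule uniformizer[OF M])
  have "a \<in> M" using a mem_max_ideal_iff[OF M] by (simp add: val_ge_def)
  define T where "T = {N \<in> noninvertible_max_ideals A. a \<in> N} - {M}"
  have "finite T" using finite_noninvertible_max_ideals[OF wf a(1,2)] by (simp add: T_def)
  have T: "N \<in> max_ideals A" "N \<noteq> M" if "N \<in> T" for N
    using that by (auto simp: T_def noninvertible_max_ideals_def)
  obtain x where x: "x \<in> M" "\<And>N. N \<in> T \<Longrightarrow> x \<notin> N"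
    using max_ideal_avoidance[OF M \<open>finite T\<close>, of thesis] T by blast
  have xA: "x \<in> A" using x(1) ideal_subset[OF idM] by blast
  define H where "H = {a * r + x * t |r t. r \<in> A \<and> t \<in> A}"
  have inv: "invertible_ideal A H" unfolding H_def by (rule invertible_two_generated[OF a(1,2) xA])
  note nzH = invertible_idealD(1)[OF inv]
  have "a * r + x * t \<in> M" if "r \<in> A" "t \<in> A" for r t
    using that ideal_add[OF idM ideal_mult_right[OF idM _ \<open>a \<in> M\<close>] ideal_mult_right[OF idM _ x(1)]] by blast
  then have "H \<subseteq> M" by (auto simp: H_def)
  have gen: "a \<in> H" "x \<in> H"
  proof -
    have "a = a * 1 + x * 0 \<and> 1 \<in> A \<and> 0 \<in> A" by simp
    then show "a \<in> H" unfolding H_def by blast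
    have "x = a * 0 + x * 1 \<and> 0 \<in> A \<and> 1 \<in> A" by simp
    then show "x \<in> H" unfolding H_def by blast
  qed
  have "V_set A 1 H \<inter> noninvertible_max_ideals A = {M}"
  proof
    show "{M} \<subseteq> V_set A 1 H \<inter> noninvertible_max_ideals A"
      using MZ M \<open>H \<subseteq> M\<close> subset_max_ideal_iff[OF M nzH] by (simp add: V_set_eq[OF nzH])
    show "V_set A 1 H \<inter> noninvertible_max_ideals A \<subseteq> {M}"
    proof
      fix N assume N: "N \<in> V_set A 1 H \<inter> noninvertible_max_ideals A"
      then have "H \<subseteq> N" using subset_max_ideal_iff[OF _ nzH] by (simp add: V_set_eq[OF nzH])
      then have "a \<in> N" "N \<notin> T" using gen x(2) by blast+
      then show "N \<in> {M}" using N by (simp add: T_def)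
    qed
  qed
  moreover have "ideal_val M H \<le> 1" using ideal_val_le[OF M nzH gen(1) a(2)] a(3) by simp
  then have "\<not> H \<subseteq> ideal_power A M 2" using subset_max_power_iff[OF M nzH] by simp
  ultimately have "clean_ideal A H" using inv unfolding clean_ideal_def by blast
  then show ?thesis using \<open>H \<subseteq> M\<close> by blast
qed

text \<open>The invertible factor is taken to be \<open>A\<close>. Factors equal to \<open>A\<close>
  have value 0 everywhere and are dropped; since \<open>I\<close> is proper, some factor
  remains.\<close>

lemma ISP_domain_if_SP_domain:
  assumes SP: "SP_domain A"
  shows "ISP_domain A"
  unfolding ISP_domain_def
proof (intro conjI allI impI)
  show "domain_with_quotient_field A" by (rule quotients)
  fix I assume "ideal I (ring_on A) \<and> I \<noteq> {0} \<and> I \<noteq> A"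
  then have I: "nonzero_ideal I" and "I \<noteq> A" by (simp_all add: nonzero_ideal_def)
  obtain Qs where rad: "\<And>Q. Q \<in> set Qs \<Longrightarrow> radical_ideal A Q" and fact: "I = ideal_list_prod A Qs"
    using SP nonzero_idealD(1)[OF I] unfolding SP_domain_def by blast
  have Qs: "nonzero_ideal Q" if "Q \<in> set Qs" for Q
  proof -
    have id: "ideal R (ring_on A)" if "R \<in> set Qs" for R using rad[OF that] by (simp add: radical_ideal_def)
    have "I \<subseteq> Q" unfolding fact using ideal_list_prod_subset(2)[of Qs Q] id that by blast
    then show ?thesis using nonzero_idealD(3)[OF I] nonzero_idealI[OF id[OF that]] by blast
  qed
  define Qs' where "Qs' = filter (\<lambda>Q. Q \<noteq> A) Qs"
  have Qs': "nonzero_ideal Q" if "Q \<in> set Qs'" for Q using that Qs by (simp add: Qs'_def)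
  have val: "(\<Sum>Q\<leftarrow>Qs'. ideal_val M Q) = ideal_val M I" if M: "M \<in> max_ideals A" for M
  proof -
    have "(\<Sum>Q\<leftarrow>Qs'. ideal_val M Q) = (\<Sum>Q\<leftarrow>Qs. ideal_val M Q)"
      unfolding Qs'_def by (rule sum_list_map_filter) (use ideal_val_ring[OF M] in auto)
    then show ?thesis unfolding fact using ideal_val_list_prod[OF M] Qs by simp
  qed
  have "Qs' \<noteq> []"
  proof
    assume "Qs' = []"
    then have "I = A" using val ideal_val_ring by (intro ideal_eqI[OF I nonzero_ideal_ring]) simp
    then show False using \<open>I \<noteq> A\<close> by blast
  qed
  moreover have "I = ideal_prod (ring_on A) A (ideal_list_prod A Qs')"
  proof (rule ideal_eqI[OF I])
    have nz: "nonzero_ideal (ideal_list_prod A Qs')" by (rule nonzero_ideal_list_prod) (rule Qs')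
    show "nonzero_ideal (ideal_prod (ring_on A) A (ideal_list_prod A Qs'))"
      by (rule nonzero_ideal_prod[OF nonzero_ideal_ring nz])
    show "ideal_val M I = ideal_val M (ideal_prod (ring_on A) A (ideal_list_prod A Qs'))"
      if M: "M \<in> max_ideals A" for M
      using ideal_val_prod[OF M nonzero_ideal_ring nz] ideal_val_ring[OF M] val[OF M]
        ideal_val_list_prod[OF M Qs'] by simp
  qed
  moreover have "invertible_ideal A A"
  proof (rule invertible_idealI[OF ideal_ring])
    show "\<exists>i\<in>A. \<exists>g\<in>frac_inverse A A. g * i \<notin> M" if "M \<in> max_ideals A" for M
      using max_idealsD(2)[OF that] one_frac_inverse[OF order_refl] 
      by (intro bexI[of _ 1]) simp_all
  qed
  moreover have "\<forall>Q\<in>set Qs'. radical_ideal A Q \<and> Q \<noteq> A" using rad by (simp add: Qs'_def)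
  ultimately show "\<exists>J Qs. invertible_ideal A J \<and> Qs \<noteq> [] \<and> (\<forall>Q\<in>set Qs. radical_ideal A Q \<and> Q \<noteq> A) \<and>
      I = ideal_prod (ring_on A) J (ideal_list_prod A Qs)" by blast
qed

end

section \<open>The cycle of implications from (a) through (b), (c) and (d) back to (a)\<close>

theorem theorem13:
  fixes A :: "'k::field set" and Z :: "'k set set"
  assumes "almost_dedekind A"
    and "weak_factorization A"
    and "Z = noninvertible_max_ideals A"
  shows "(SP_domain A \<longleftrightarrow> ISP_domain A) \<and>
         (ISP_domain A \<longleftrightarrow> (\<forall>H. clean_ideal A H \<longrightarrow> finite (V_set A 2 H))) \<and>
         ((\<forall>H. clean_ideal A H \<longrightarrow> finite (V_set A 2 H)) \<longleftrightarrow>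
          (\<forall>M\<in>Z. \<exists>H. clean_ideal A H \<and> H \<subseteq> M \<and> finite (V_set A 2 H)))"
proof -
  interpret almost_dedekind_domain A by unfold_locales (rule assms(1))
  have "ISP_domain A" if "SP_domain A"
    using that by (rule ISP_domain_if_SP_domain)
  moreover have "\<forall>H. clean_ideal A H \<longrightarrow> finite (V_set A 2 H)" if "ISP_domain A"
    using finite_V_set_if_ISP_domain[OF that] by blast
  moreover have "\<forall>M\<in>Z. \<exists>H. clean_ideal A H \<and> H \<subseteq> M \<and> finite (V_set A 2 H)"
    if "\<forall>H. clean_ideal A H \<longrightarrow> finite (V_set A 2 H)"
    using that exists_clean_ideal[OF assms(2)] unfolding assms(3) by blast
  moreover have "SP_domain A" if "\<forall>M\<in>Z. \<exists>H. clean_ideal A H \<and> H \<subseteq> M \<and> finite (V_set A 2 H)"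
    using that unfolding assms(3) by (intro SP_domain_if_clean_ideals) blast
  ultimately show ?thesis by blast
qed

end
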